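(* For all integers $s\geq 2$ and $k\geq 3$, there exists $C>0$ such that the following holds. Let $p=p(n)\geq C n^{2-s-1/m_2(K_{k-1})}$ and $\mathcal{H} = \mathcal{H}_s(n,p)$. Then for every function $\varepsilon(n)\to 0$, with probability tending to $1$ as $n\to\infty$, every subhypergraph $\mathcal{H}_0 \subseteq \mathcal{H}$ with at least $(1 - \varepsilon(n))e(\mathcal{H})$ hyperedges satisfies $G[\mathcal{H}_0] \rightarrow (K_{s}, K_{k-1})$.
   Context: The maximum $2$-density of a graph $F$ is $m_2(F)=\max\{\frac{e(J)-1}{v(J)-2} : J\subseteq F,\ v(J)\geq 3\}$, where $e(J),v(J)$ are the numbers of edges and vertices of $J$. The random $s$-uniform hypergraph $\mathcal{H}_s(n,p)$ has vertex set of size $n$ and contains each $s$-element subset of vertices as a hyperedge independently with probability $p$; $e(\mathcal{H})$ denotes its number of hyperedges. For an $s$-uniform hypergraph $\mathcal{H}$, the primal graph $G[\mathcal{H}]$ has vertex set $V(\mathcal{H})$ and edge set all pairs of vertices contained together in some hyperedge of $\mathcal{H}$. For a graph $G$, $G \rightarrow (K_a,K_b)$ means every red-blue colouring of the edges of $G$ contains a red copy of $K_a$ or a blue copy of $K_b$.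
   Formalization: For k=3 the quantity m_2(K_2) is a maximum over an empty set and hence undefined; it is taken to be 1 (the value 1/2 would make the claim false). The bound on p(n) is required only for all sufficiently large n. *)

theory Defs
  imports "HOL-Probability.Probability"
begin

text \<open>A hypergraph is a pair of a vertex set and a set of hyperedges; a graph is a hypergraph all of
  whose hyperedges have exactly two elements.\<close>

type_synonym 'a hypergraph = "'a set \<times> 'a set set"

abbreviation verts :: "'a hypergraph \<Rightarrow> 'a set" where
  "verts H \<equiv> fst H"

abbreviation edges :: "'a hypergraph \<Rightarrow> 'a set set" where
  "edges H \<equiv> snd H"

definition subhypergraph :: "'a hypergraph \<Rightarrow> 'a hypergraph \<Rightarrow> bool" where
  "subhypergraph J H \<longleftrightarrow>
     verts J \<subseteq> verts H \<and> edges J \<subseteq> edges H \<and> (\<forall>e\<in>edges J. e \<subseteq> verts J)"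

definition hypergraph_iso :: "'a hypergraph \<Rightarrow> 'b hypergraph \<Rightarrow> bool" where
  "hypergraph_iso F J \<longleftrightarrow>
     (\<exists>f. bij_betw f (verts F) (verts J) \<and> edges J = (\<lambda>e. f ` e) ` edges F)"

definition complete_hypergraph :: "nat \<Rightarrow> nat \<Rightarrow> nat hypergraph" where
  "complete_hypergraph s n = ({..<n}, {e. e \<subseteq> {..<n} \<and> card e = s})"

abbreviation complete_graph :: "nat \<Rightarrow> nat hypergraph" where
  "complete_graph r \<equiv> complete_hypergraph 2 r"

text \<open>Meant for finite graphs. A graph on fewer than three vertices has no subgraph to maximise over;
  its maximum 2-density is set to 1. The other common convention, \<open>m\<^sub>2(K\<^sub>2) = 1/2\<close>, would give
  \<open>p = C n\<^bsup>-s\<^esup>\<close>, where the random hypergraph is edgeless with probability bounded away from 0.\<close>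

definition max_2_density :: "'a hypergraph \<Rightarrow> real" where
  "max_2_density F =
     (if card (verts F) < 3 then 1
      else Max {(real (card (edges J)) - 1) / (real (card (verts J)) - 2) | J.
                  subhypergraph J F \<and> card (verts J) \<ge> 3})"

definition primal_graph :: "'a hypergraph \<Rightarrow> 'a hypergraph" where
  "primal_graph H = (verts H, {{u, v} | u v. u \<noteq> v \<and> (\<exists>e\<in>edges H. u \<in> e \<and> v \<in> e)})"

datatype colour = Red | Blue

text \<open>Only the values of a colouring on the edges of \<open>G\<close> matter.\<close>

definition monochromatic_copy ::
  "'a hypergraph \<Rightarrow> ('a set \<Rightarrow> colour) \<Rightarrow> colour \<Rightarrow> 'b hypergraph \<Rightarrow> bool" where
  "monochromatic_copy G col c F \<longleftrightarrow>
     (\<exists>J. subhypergraph J G \<and> hypergraph_iso F J \<and> (\<forall>e\<in>edges J. col e = c))"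

definition ramsey_arrow :: "'a hypergraph \<Rightarrow> 'b hypergraph \<Rightarrow> 'c hypergraph \<Rightarrow> bool" where
  "ramsey_arrow G F1 F2 \<longleftrightarrow>
     (\<forall>col. monochromatic_copy G col Red F1 \<or> monochromatic_copy G col Blue F2)"

definition random_hypergraph :: "nat \<Rightarrow> nat \<Rightarrow> real \<Rightarrow> nat hypergraph pmf" where
  "random_hypergraph s n p =
     map_pmf (\<lambda>X. ({..<n}, {e \<in> edges (complete_hypergraph s n). X e}))
       (Pi_pmf (edges (complete_hypergraph s n)) False (\<lambda>_. bernoulli_pmf p))"

end

theory Submission
  imports Defs "HOL-Library.Ramsey"
begin

text \<open>
  Put \<open>r = k - 1\<close>. If \<open>H\<^sub>0\<close> has a colouring with no red \<open>K\<^sub>s\<close> and no blue \<open>K\<^sub>r\<close>, then the blue graph \<open>B\<close> is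
  \<open>K\<^sub>r\<close>-free and every hyperedge of \<open>H\<^sub>0\<close> contains an edge of \<open>B\<close>. By the hypergraph container method,
  \<open>B\<close> lies in a graph \<open>C\<close> with few copies of \<open>K\<^sub>r\<close> that is determined by boundedly many fingerprints,
  subsets of \<open>B\<close> of size \<open>O(n powr (2 - 1/m\<^sub>2(K\<^sub>r)))\<close>. By Ramsey's theorem and averaging, a positive
  proportion of all \<open>s\<close>-sets spans no edge of \<open>C\<close>; none of these is in \<open>H\<^sub>0\<close>, so almost none of them is
  in \<open>H\<close>, which for a fixed \<open>C\<close> has probability \<open>exp (- \<Omega>(p n\<^sup>s))\<close>. The fingerprints are covered by
  few hyperedges of \<open>H\<^sub>0\<close>, disjoint from those \<open>s\<close>-sets. In the union bound over the fingerprints these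
  covering hyperedges contribute a factor \<open>p\<close> each, so for a large constant in the lower bound on \<open>p\<close> the
  number of fingerprints is outweighed by that exponential.
\<close>

section \<open>Containers determined by fingerprints\<close>

definition fingerprints :: "real \<Rightarrow> nat \<Rightarrow> 'a set \<Rightarrow> 'a set list set" where
  "fingerprints t m I = {L. length L = m \<and> (\<forall>F\<in>set L. F \<subseteq> I \<and> real (card F) \<le> t)}"

definition container_function ::
  "real \<Rightarrow> nat \<Rightarrow> 'a set set \<Rightarrow> 'a set set \<Rightarrow> ('a set list \<Rightarrow> 'a set) \<Rightarrow> bool" where
  "container_function t m \<I> \<C> f \<longleftrightarrow> (\<forall>I\<in>\<I>. \<exists>L\<in>fingerprints t m I. I \<subseteq> f L \<and> f L \<in> \<C>)"

definition has_containers :: "real \<Rightarrow> nat \<Rightarrow> 'a set set \<Rightarrow> 'a set set \<Rightarrow> bool" where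
  "has_containers t m \<I> \<C> \<longleftrightarrow> (\<exists>f. container_function t m \<I> \<C> f)"

lemma card_Union_fingerprints_le:
  assumes "L \<in> fingerprints t m I" and "0 \<le> t"
  shows "real (card (\<Union>(set L))) \<le> real m * t"
proof -
  have "real (card (\<Union>(set L))) \<le> (\<Sum>F\<in>set L. real (card F))"
    using card_Union_le_sum_card[of "set L"] by (simp flip: of_nat_sum)
  also have "\<dots> \<le> real (card (set L)) * t"
    using assms(1) by (intro sum_bounded_above) (auto simp: fingerprints_def)
  also have "\<dots> \<le> real m * t"
    using assms card_length[of L] by (intro mult_right_mono) (auto simp: fingerprints_def)
  finally show ?thesis .
qed

lemma has_containers_single:
  assumes "\<And>I. I \<in> \<I> \<Longrightarrow> I \<subseteq> C" and "C \<in> \<C>" and "0 \<le> t"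
  shows "has_containers t m \<I> \<C>"
proof -
  have "replicate m {} \<in> fingerprints t m I" for I :: "'a set"
    using assms(3) by (auto simp: fingerprints_def)
  with assms(1,2) show ?thesis
    unfolding has_containers_def container_function_def by (intro exI[of _ "\<lambda>_. C"]) blast
qed

lemma has_containers_mono:
  assumes "has_containers t m \<J> \<C>" and "\<I> \<subseteq> \<J>" and "\<C> \<subseteq> \<D>" and "t \<le> t'"
  shows "has_containers t' m \<I> \<D>"
proof -
  have "fingerprints t m I \<subseteq> fingerprints t' m I" for I :: "'a set"
    using assms(4) by (auto simp: fingerprints_def)
  with assms(1-3) show ?thesis
    unfolding has_containers_def container_function_def by (meson in_mono)
qed

lemma has_containers_Suc:
  assumes first: "\<And>I. I \<in> \<I> \<Longrightarrow> \<exists>F. F \<subseteq> I \<and> real (card F) \<le> t \<and> I \<in> \<J> F"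
    and rest: "\<And>F. has_containers t m (\<J> F) \<C>"
  shows "has_containers t (Suc m) \<I> \<C>"
proof -
  from rest obtain g
    where g_container: "\<And>F I. I \<in> \<J> F \<Longrightarrow> \<exists>L\<in>fingerprints t m I. I \<subseteq> g F L \<and> g F L \<in> \<C>"
    unfolding has_containers_def container_function_def by metis
  have "\<exists>L\<in>fingerprints t (Suc m) I. I \<subseteq> g (hd L) (tl L) \<and> g (hd L) (tl L) \<in> \<C>"
    if "I \<in> \<I>" for I
  proof -
    from first[OF that] obtain F where F: "F \<subseteq> I" "real (card F) \<le> t" and "I \<in> \<J> F" by blast
    then obtain L where "L \<in> fingerprints t m I" "I \<subseteq> g F L" "g F L \<in> \<C>"
      using g_container by blast
    with F show ?thesis by (intro bexI[of _ "F # L"]) (auto simp: fingerprints_def)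
  qed
  then show ?thesis
    unfolding has_containers_def container_function_def by (intro exI[of _ "\<lambda>L. g (hd L) (tl L)"]) blast
qed

lemma has_containers_trans:
  assumes outer: "has_containers t m \<I> \<C>"
    and inner: "\<And>C. C \<in> \<C> \<Longrightarrow> has_containers t m' (\<I> \<inter> Pow C) \<D>"
  shows "has_containers t (m + m') \<I> \<D>"
proof -
  from outer obtain f
    where f_container: "\<And>I. I \<in> \<I> \<Longrightarrow> \<exists>L\<in>fingerprints t m I. I \<subseteq> f L \<and> f L \<in> \<C>"
    unfolding has_containers_def container_function_def by blast
  from inner obtain g where g_container: "\<And>C I. C \<in> \<C> \<Longrightarrow> I \<in> \<I> \<inter> Pow C \<Longrightarrow>
      \<exists>L\<in>fingerprints t m' I. I \<subseteq> g C L \<and> g C L \<in> \<D>"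
    unfolding has_containers_def container_function_def by metis
  define h where "h L = g (f (take m L)) (drop m L)" for L
  have "\<exists>L\<in>fingerprints t (m + m') I. I \<subseteq> h L \<and> h L \<in> \<D>" if "I \<in> \<I>" for I
  proof -
    from f_container[OF that] obtain L
      where L: "L \<in> fingerprints t m I" and "I \<subseteq> f L" "f L \<in> \<C>" by blast
    then obtain L' where "L' \<in> fingerprints t m' I" "I \<subseteq> g (f L) L'" "g (f L) L' \<in> \<D>"
      using g_container[of "f L" I] \<open>I \<in> \<I>\<close> by blast
    with L show ?thesis
      by (intro bexI[of _ "L @ L'"]) (auto simp: fingerprints_def h_def)
  qed
  then show ?thesis unfolding has_containers_def container_function_def by blast
qed

definition shrunk :: "'a set \<Rightarrow> real \<Rightarrow> 'a set set" where
  "shrunk V d = {C. C \<subseteq> V \<and> real (card C) + d \<le> real (card V)}"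

lemma has_containers_by_shrinking:
  assumes shrink: "\<And>C. C \<subseteq> V \<Longrightarrow> C \<notin> \<S> \<Longrightarrow> has_containers t m (\<I> \<inter> Pow C) (shrunk C d)"
    and "\<I> \<subseteq> Pow V" and "0 \<le> t" and "real (card V) < real j * d"
  shows "has_containers t (j * m) \<I> (\<S> \<inter> Pow V)"
proof -
  have "has_containers t (j * m) \<I> (\<S> \<inter> Pow V \<union> shrunk V (real j * d))" for j
  proof (induction j)
    case 0
    show ?case
      by (rule has_containers_single[of _ V]) (use assms(2,3) in \<open>auto simp: shrunk_def\<close>)
  next
    case (Suc j)
    have "has_containers t m (\<I> \<inter> Pow C) (\<S> \<inter> Pow V \<union> shrunk V (real (Suc j) * d))"
      if "C \<in> \<S> \<inter> Pow V \<union> shrunk V (real j * d)" for C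
    proof (cases "C \<in> \<S>")
      case True
      with that assms(3) show ?thesis by (intro has_containers_single[of _ C]) (auto simp: shrunk_def)
    next
      case False
      with that have "C \<in> shrunk V (real j * d)" by simp
      then have "C \<subseteq> V" and further: "shrunk C d \<subseteq> shrunk V (real (Suc j) * d)"
        by (auto simp: shrunk_def algebra_simps)
      show ?thesis
        by (rule has_containers_mono[OF shrink[OF \<open>C \<subseteq> V\<close> False]]) (use further in blast)+
    qed
    from has_containers_trans[OF Suc.IH this] show ?case by (simp add: add.commute)
  qed
  moreover have "shrunk V (real j * d) = {}" using assms(4) by (auto simp: shrunk_def)
  ultimately show ?thesis by (metis sup_bot_right)
qed

section \<open>Hypergraph containers\<close>

definition codegree :: "'a set set \<Rightarrow> 'a set \<Rightarrow> nat" where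
  "codegree H S = card {h \<in> H. S \<subseteq> h}"

definition independent_sets :: "'a set \<Rightarrow> 'a set set \<Rightarrow> 'a set set" where
  "independent_sets V H = {I. I \<subseteq> V \<and> (\<forall>h\<in>H. \<not> h \<subseteq> I)}"

lemma codegree_mono: "finite H \<Longrightarrow> G \<subseteq> H \<Longrightarrow> codegree G S \<le> codegree H S"
  unfolding codegree_def by (rule card_mono) auto

lemma codegree_eq_0: "(\<And>h. h \<in> H \<Longrightarrow> \<not> S \<subseteq> h) \<Longrightarrow> codegree H S = 0"
  unfolding codegree_def by (metis (no_types, lifting) card.empty empty_Collect_eq)

lemma finite_uniform: "finite V \<Longrightarrow> H \<subseteq> [V]\<^bsup>k\<^esup> \<Longrightarrow> finite H"
  using finite_imp_finite_nsets finite_subset by blast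

lemma sum_codegree_Pow:
  assumes "finite V" and "H \<subseteq> [V]\<^bsup>k\<^esup>"
  shows "(\<Sum>S\<in>Pow V. codegree H S) = 2 ^ k * card H"
  unfolding codegree_def
proof (rule sum_multicount)
  show "\<forall>h\<in>H. card {S \<in> Pow V. S \<subseteq> h} = 2 ^ k"
  proof
    fix h assume "h \<in> H"
    then have "h \<subseteq> V" "finite h" "card h = k" using assms(2) by (auto simp: nsets_def)
    then have "{S \<in> Pow V. S \<subseteq> h} = Pow h" by auto
    with \<open>finite h\<close> \<open>card h = k\<close> show "card {S \<in> Pow V. S \<subseteq> h} = 2 ^ k" by (simp add: card_Pow)
  qed
qed (use assms finite_uniform in auto)

lemma sum_codegree_singletons:
  assumes "finite V" and "H \<subseteq> [V]\<^bsup>k\<^esup>"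
  shows "(\<Sum>x\<in>V. codegree H {x}) = k * card H"
  unfolding codegree_def
proof (rule sum_multicount)
  show "\<forall>h\<in>H. card {x \<in> V. {x} \<subseteq> h} = k"
  proof
    fix h assume "h \<in> H"
    then have "h \<subseteq> V" "card h = k" using assms(2) by (auto simp: nsets_def)
    moreover from this have "{x \<in> V. {x} \<subseteq> h} = h" by auto
    ultimately show "card {x \<in> V. {x} \<subseteq> h} = k" by simp
  qed
qed (use assms finite_uniform in auto)

text \<open>The usual condition \<open>d\<^sub>j \<le> \<beta> * d * \<tau>\<^bsup>j-1\<^esup>\<close> on the maximum codegree \<open>d\<^sub>j\<close> of \<open>j\<close>-sets, scaled so that
  the average degree \<open>d\<close> is \<open>\<tau>\<^bsup>1-k\<^esup>\<close>. For sets with more than \<open>k\<close> elements the truncated subtraction is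
  harmless, since their codegree is 0.\<close>

locale bounded_codegrees =
  fixes V :: "'a set" and H :: "'a set set" and k :: nat and \<tau> \<beta> :: real
  assumes finite_V: "finite V" and uniform: "H \<subseteq> [V]\<^bsup>k\<^esup>" and \<tau>_pos: "0 < \<tau>"
    and codegree_le: "\<And>S. S \<noteq> {} \<Longrightarrow> S \<subseteq> V \<Longrightarrow> real (codegree H S) * \<tau> ^ (k - card S) \<le> \<beta>"
begin

lemma finite_H: "finite H"
  using finite_V uniform by (rule finite_uniform)

lemma bounded_codegrees_restrict:
  assumes "C \<subseteq> V"
  shows "bounded_codegrees C (H \<inter> Pow C) k \<tau> \<beta>"
proof
  show "finite C" using assms finite_V by (rule finite_subset)
  show "H \<inter> Pow C \<subseteq> [C]\<^bsup>k\<^esup>" using uniform by (auto simp: nsets_def)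
  fix S assume "S \<noteq> {}" "S \<subseteq> C"
  have "codegree (H \<inter> Pow C) S \<le> codegree H S" by (rule codegree_mono[OF finite_H]) simp
  then have "real (codegree (H \<inter> Pow C) S) * \<tau> ^ (k - card S) \<le> real (codegree H S) * \<tau> ^ (k - card S)"
    using \<tau>_pos by (intro mult_right_mono) auto
  also have "\<dots> \<le> \<beta>" using \<open>S \<noteq> {}\<close> \<open>S \<subseteq> C\<close> assms by (intro codegree_le) auto
  finally show "real (codegree (H \<inter> Pow C) S) * \<tau> ^ (k - card S) \<le> \<beta>" .
qed (rule \<tau>_pos)

end

text \<open>One level of the container construction: links in \<open>H\<close> of the vertices of a fingerprint \<open>F\<close> are
  collected into a hypergraph \<open>G\<close> of uniformity one less. A link edge is left out once it contains a
  set of large codegree in \<open>G\<close>, so codegrees overshoot the cap by at most the contribution of a single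
  vertex. Edges of \<open>G\<close> are themselves saturated and hence are never added twice.\<close>

locale container_level = bounded_codegrees V H "Suc (Suc i)" \<tau> \<beta>
  for V :: "'a set" and H :: "'a set set" and i :: nat and \<tau> \<beta> :: real +
  fixes \<theta> :: real
  assumes \<beta>_pos: "0 < \<beta>" and \<theta>_pos: "0 < \<theta>"
begin

definition saturated :: "'a set set \<Rightarrow> 'a set set" where
  "saturated G = {S. S \<noteq> {} \<and> S \<subseteq> V \<and> 1 \<le> real (codegree G S) * \<tau> ^ (Suc i - card S)}"

definition free_link :: "'a set set \<Rightarrow> 'a \<Rightarrow> 'a set set" where
  "free_link G x = {e. x \<notin> e \<and> insert x e \<in> H \<and> (\<forall>S\<in>saturated G. \<not> S \<subseteq> e)}"

definition heavy :: "'a set set \<Rightarrow> 'a set" where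
  "heavy G = {x \<in> V. \<theta> \<le> real (card (free_link G x)) * \<tau> ^ Suc i}"

inductive builds :: "'a set \<Rightarrow> 'a set set \<Rightarrow> bool" where
  empty: "builds {} {}"
| insert: "builds F G \<Longrightarrow> x \<in> heavy G \<Longrightarrow> builds (insert x F) (G \<union> free_link G x)"

lemma free_link_uniform: "free_link G x \<subseteq> [V]\<^bsup>Suc i\<^esup>"
  using uniform by (auto simp: free_link_def nsets_def)

lemma finite_free_link: "finite (free_link G x)"
  using finite_V free_link_uniform by (rule finite_uniform)

lemma codegree_free_link_le:
  assumes "x \<notin> S"
  shows "codegree (free_link G x) S \<le> codegree H (insert x S)"
  unfolding codegree_def
proof (rule card_inj_on_le[of "insert x"])
  show "inj_on (insert x) {e \<in> free_link G x. S \<subseteq> e}"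
    by (rule inj_onI) (auto simp: free_link_def)
qed (use finite_H in \<open>auto simp: free_link_def\<close>)

lemma builds_uniform: "builds F G \<Longrightarrow> G \<subseteq> [V]\<^bsup>Suc i\<^esup>"
  by (induction rule: builds.induct) (use free_link_uniform in auto)

lemma builds_finite: "builds F G \<Longrightarrow> finite F \<and> finite G"
  by (induction rule: builds.induct) (auto simp: finite_free_link)

lemma builds_extends: "builds F G \<Longrightarrow> e \<in> G \<Longrightarrow> \<exists>x\<in>F. insert x e \<in> H"
  by (induction rule: builds.induct) (auto simp: free_link_def)

lemma builds_independent:
  assumes "builds F G" and "F \<subseteq> I" and "I \<in> independent_sets V H"
  shows "I \<in> independent_sets V G"
proof -
  have "\<not> e \<subseteq> I" if "e \<in> G" for e
    using builds_extends[OF assms(1) that] assms(2,3) by (auto simp: independent_sets_def)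
  with assms(3) show ?thesis by (auto simp: independent_sets_def)
qed

lemma builds_disjoint_free_link:
  assumes "builds F G"
  shows "G \<inter> free_link G x = {}"
proof -
  have "e \<in> saturated G" if "e \<in> G" for e
  proof -
    have "e \<subseteq> V" "card e = Suc i" using that builds_uniform[OF assms] by (auto simp: nsets_def)
    moreover have "0 < codegree G e"
      using that builds_finite[OF assms] by (auto simp: codegree_def card_gt_0_iff)
    ultimately show ?thesis by (auto simp: saturated_def)
  qed
  then show ?thesis by (auto simp: free_link_def)
qed

lemma builds_card_ge: "builds F G \<Longrightarrow> \<theta> * real (card F) \<le> real (card G) * \<tau> ^ Suc i"
proof (induction rule: builds.induct)
  case (insert F G x)
  have "\<theta> * real (card (insert x F)) \<le> \<theta> * real (card F) + \<theta>"
    using \<theta>_pos builds_finite[OF insert.hyps(1)] by (simp add: card_insert_if algebra_simps)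
  also have "\<dots> \<le> real (card G) * \<tau> ^ Suc i + real (card (free_link G x)) * \<tau> ^ Suc i"
    using insert.IH insert.hyps(2) by (simp add: heavy_def)
  also have "\<dots> = real (card (G \<union> free_link G x)) * \<tau> ^ Suc i"
    using builds_finite[OF insert.hyps(1)] builds_disjoint_free_link[OF insert.hyps(1)]
    by (simp add: card_Un_disjoint finite_free_link distrib_right)
  finally show ?case .
qed simp

lemma builds_codegree_le:
  assumes "builds F G" and "S \<noteq> {}" and "S \<subseteq> V"
  shows "real (codegree G S) * \<tau> ^ (Suc i - card S) \<le> 1 + \<beta>"
  using assms
proof (induction rule: builds.induct)
  case empty
  show ?case using \<beta>_pos by (simp add: codegree_def)
next
  case (insert F G x)
  let ?w = "\<tau> ^ (Suc i - card S)"
  have union: "{h \<in> G \<union> free_link G x. S \<subseteq> h} = {h \<in> G. S \<subseteq> h} \<union> {h \<in> free_link G x. S \<subseteq> h}" by auto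
  show ?case
  proof (cases "S \<in> saturated G \<or> x \<in> S")
    case True
    then have "{h \<in> free_link G x. S \<subseteq> h} = {}" by (auto simp: free_link_def)
    then have "codegree (G \<union> free_link G x) S = codegree G S"
      unfolding codegree_def union by (simp only: Un_empty_right)
    with insert show ?thesis by simp
  next
    case False
    have "finite S" using insert.prems(2) finite_V by (rule finite_subset)
    have "codegree (G \<union> free_link G x) S \<le> codegree G S + codegree (free_link G x) S"
      unfolding codegree_def union by (rule card_Un_le)
    also have "codegree (free_link G x) S \<le> codegree H (insert x S)"
      using False by (intro codegree_free_link_le) simp
    finally have "real (codegree (G \<union> free_link G x) S) * ?w
        \<le> real (codegree G S + codegree H (insert x S)) * ?w"
      using \<tau>_pos by (intro mult_right_mono) auto
    moreover have "real (codegree G S) * ?w < 1"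
      using False insert.prems by (auto simp: saturated_def)
    moreover have "real (codegree H (insert x S)) * ?w \<le> \<beta>"
      using codegree_le[of "insert x S"] False insert \<open>finite S\<close> by (simp add: heavy_def)
    ultimately show ?thesis by (simp add: algebra_simps)
  qed
qed

lemma bounded_codegrees_builds:
  assumes "builds F G"
  shows "bounded_codegrees V G (Suc i) \<tau> (1 + \<beta>)"
  using finite_V builds_uniform[OF assms] \<tau>_pos builds_codegree_le[OF assms] by unfold_locales

lemma builds_card_le:
  assumes "builds F G"
  shows "real (card G) * \<tau> ^ i \<le> real (card V) * (1 + \<beta>)"
proof -
  have "card G \<le> (\<Sum>x\<in>V. codegree G {x})"
    using sum_codegree_singletons[OF finite_V builds_uniform[OF assms]] by simp
  then have "real (card G) * \<tau> ^ i \<le> (\<Sum>x\<in>V. real (codegree G {x}) * \<tau> ^ i)"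
    using \<tau>_pos by (simp add: mult_right_mono flip: of_nat_sum sum_distrib_right)
  also have "\<dots> \<le> real (card V) * (1 + \<beta>)"
    using builds_codegree_le[OF assms, of "{_}"] by (intro sum_bounded_above) auto
  finally show ?thesis .
qed

lemma card_fingerprint_le:
  assumes "builds F G"
  shows "real (card F) \<le> (1 + \<beta>) / \<theta> * \<tau> * real (card V)"
proof -
  have "\<theta> * real (card F) \<le> \<tau> * (real (card G) * \<tau> ^ i)"
    using builds_card_ge[OF assms] by (simp add: mult_ac)
  also have "\<dots> \<le> \<tau> * (real (card V) * (1 + \<beta>))"
    using builds_card_le[OF assms] \<tau>_pos by (intro mult_left_mono) auto
  finally show ?thesis using \<theta>_pos by (simp add: field_simps)
qed

lemma edges_subset_saturated_Un_free_links:
  "H \<subseteq> (\<Union>S\<in>saturated G. {h \<in> H. S \<subseteq> h}) \<union> (\<Union>x\<in>V. insert x ` free_link G x)"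
proof
  fix h assume "h \<in> H"
  show "h \<in> (\<Union>S\<in>saturated G. {h \<in> H. S \<subseteq> h}) \<union> (\<Union>x\<in>V. insert x ` free_link G x)"
  proof (cases "\<exists>S\<in>saturated G. S \<subseteq> h")
    case False
    have "h \<subseteq> V" "h \<noteq> {}" using \<open>h \<in> H\<close> uniform by (auto simp: nsets_def)
    then obtain x where x_in: "x \<in> h" "x \<in> V" by auto
    then have insert_x: "insert x (h - {x}) = h" by auto
    then have "h - {x} \<in> free_link G x" using False \<open>h \<in> H\<close> by (auto simp: free_link_def)
    then have "h \<in> insert x ` free_link G x" using insert_x by (metis imageI)
    with x_in show ?thesis by blast
  qed (use \<open>h \<in> H\<close> in auto)
qed

lemma sum_codegree_saturated_le:
  assumes "G \<subseteq> [V]\<^bsup>Suc i\<^esup>"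
  shows "(\<Sum>S\<in>saturated G. real (codegree H S)) * \<tau> \<le> \<beta> * 2 ^ Suc i * real (card G)"
proof -
  have "real (codegree H S) * \<tau> \<le> \<beta> * real (codegree G S)" if saturated: "S \<in> saturated G" for S
  proof -
    have "codegree G S \<noteq> 0" using saturated by (auto simp: saturated_def)
    then obtain e where "e \<in> G" "S \<subseteq> e" using codegree_eq_0 by metis
    then have "card S \<le> Suc i" using assms card_mono[of e S] by (auto simp: nsets_def)
    then have "real (codegree H S) * \<tau> * \<tau> ^ (Suc i - card S) \<le> \<beta>"
      using codegree_le[of S] saturated by (simp add: saturated_def Suc_diff_le mult_ac)
    also have "\<beta> \<le> \<beta> * real (codegree G S) * \<tau> ^ (Suc i - card S)"
      using saturated \<beta>_pos by (simp add: saturated_def mult.assoc)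
    finally show ?thesis using \<tau>_pos by simp
  qed
  then have "(\<Sum>S\<in>saturated G. real (codegree H S)) * \<tau> \<le> (\<Sum>S\<in>saturated G. \<beta> * real (codegree G S))"
    unfolding sum_distrib_right by (rule sum_mono)
  also have "\<dots> \<le> (\<Sum>S\<in>Pow V. \<beta> * real (codegree G S))"
    by (rule sum_mono2) (use finite_V \<beta>_pos in \<open>auto simp: saturated_def\<close>)
  also have "\<dots> = \<beta> * 2 ^ Suc i * real (card G)"
    using sum_codegree_Pow[OF finite_V assms] by (simp flip: sum_distrib_left of_nat_sum)
  finally show ?thesis .
qed

lemma sum_free_link_le:
  "(\<Sum>x\<in>V. real (card (free_link G x))) * \<tau> ^ Suc i \<le> \<theta> * real (card V) + \<beta> * real (card (heavy G))"
proof -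
  have "real (card (free_link G x)) * \<tau> ^ Suc i \<le> \<theta> + (if x \<in> heavy G then \<beta> else 0)" if "x \<in> V" for x
  proof -
    have "card (free_link G x) \<le> codegree H {x}"
      using codegree_free_link_le[of x "{}" G] by (simp add: codegree_def)
    then have "real (card (free_link G x)) * \<tau> ^ Suc i \<le> real (codegree H {x}) * \<tau> ^ Suc i"
      using \<tau>_pos by (intro mult_right_mono) auto
    also have "\<dots> \<le> \<beta>" using codegree_le[of "{x}"] that by simp
    finally show ?thesis using that \<theta>_pos by (auto simp: heavy_def)
  qed
  then have "(\<Sum>x\<in>V. real (card (free_link G x))) * \<tau> ^ Suc i
      \<le> (\<Sum>x\<in>V. \<theta> + (if x \<in> heavy G then \<beta> else 0))"
    unfolding sum_distrib_right by (rule sum_mono)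
  also have "\<dots> = \<theta> * real (card V) + \<beta> * real (card (heavy G))"
    using finite_V by (simp add: sum.distrib sum.If_cases Int_def heavy_def)
  finally show ?thesis .
qed

lemma card_edges_le:
  assumes "G \<subseteq> [V]\<^bsup>Suc i\<^esup>"
  shows "real (card H) * \<tau> ^ Suc i
    \<le> \<beta> * 2 ^ Suc i * (real (card G) * \<tau> ^ i) + \<theta> * real (card V) + \<beta> * real (card (heavy G))"
proof -
  have finite_saturated: "finite (saturated G)"
    by (rule finite_subset[of _ "Pow V"]) (use finite_V in \<open>auto simp: saturated_def\<close>)
  have "card H \<le> card (\<Union>S\<in>saturated G. {h \<in> H. S \<subseteq> h}) + card (\<Union>x\<in>V. insert x ` free_link G x)"
    by (rule order_trans[OF card_mono[OF _ edges_subset_saturated_Un_free_links] card_Un_le])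
      (use finite_saturated finite_V finite_H finite_free_link in auto)
  also have "card (\<Union>S\<in>saturated G. {h \<in> H. S \<subseteq> h}) \<le> (\<Sum>S\<in>saturated G. codegree H S)"
    unfolding codegree_def by (rule card_UN_le[OF finite_saturated])
  also have "card (\<Union>x\<in>V. insert x ` free_link G x) \<le> (\<Sum>x\<in>V. card (free_link G x))"
    by (rule order_trans[OF card_UN_le[OF finite_V] sum_mono]) (rule card_image_le[OF finite_free_link])
  finally have "real (card H)
      \<le> (\<Sum>S\<in>saturated G. real (codegree H S)) + (\<Sum>x\<in>V. real (card (free_link G x)))"
    by (simp flip: of_nat_sum of_nat_add)
  then have "real (card H) * \<tau> ^ Suc i \<le> (\<Sum>S\<in>saturated G. real (codegree H S)) * \<tau> * \<tau> ^ i
      + (\<Sum>x\<in>V. real (card (free_link G x))) * \<tau> ^ Suc i"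
    using \<tau>_pos by (simp add: mult.assoc flip: distrib_right)
  moreover have "(\<Sum>S\<in>saturated G. real (codegree H S)) * \<tau> * \<tau> ^ i
      \<le> \<beta> * 2 ^ Suc i * real (card G) * \<tau> ^ i"
    using sum_codegree_saturated_le[OF assms] \<tau>_pos by (intro mult_right_mono) auto
  ultimately show ?thesis using sum_free_link_le[of G] by (simp add: mult.assoc)
qed

text \<open>Different orders of inserting the same vertices may build different hypergraphs. Fixing one of
  them for each set \<open>F\<close> keeps fingerprints unordered; counting ordered fingerprints would cost a
  logarithmic factor in the threshold.\<close>

definition built :: "'a set \<Rightarrow> 'a set set" where
  "built F = (SOME G. builds F G)"

definition fingerprinted_by :: "'a set \<Rightarrow> 'a set set" where
  "fingerprinted_by F =
    {I \<in> independent_sets V H. F \<subseteq> I \<and> builds F (built F) \<and> I \<subseteq> F \<union> (V - heavy (built F))}"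

lemma builds_built: "builds F G \<Longrightarrow> builds F (built F)"
  unfolding built_def by (rule someI)

lemma ex_fingerprint:
  assumes indep_I: "I \<in> independent_sets V H"
  obtains F where "I \<in> fingerprinted_by F"
proof -
  define \<F> where "\<F> = {F. F \<subseteq> I \<and> (\<exists>G. builds F G)}"
  have "I \<subseteq> V" using indep_I by (auto simp: independent_sets_def)
  have "finite \<F>"
    by (rule finite_subset[of _ "Pow V"]) (use finite_V \<open>I \<subseteq> V\<close> in \<open>auto simp: \<F>_def\<close>)
  moreover have "{} \<in> \<F>" using builds.empty by (auto simp: \<F>_def)
  ultimately obtain F where F_in: "F \<in> \<F>" and maximal: "\<And>F'. F' \<in> \<F> \<Longrightarrow> F \<subseteq> F' \<Longrightarrow> F = F'"
    using finite_has_maximal2[of \<F> "{}"] by metis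
  from F_in have "F \<subseteq> I" and builds: "builds F (built F)" by (auto simp: \<F>_def builds_built)
  have "x \<notin> heavy (built F)" if "x \<in> I" "x \<notin> F" for x
  proof
    assume "x \<in> heavy (built F)"
    then have "insert x F \<in> \<F>"
      using builds.insert[OF builds] that \<open>F \<subseteq> I\<close> by (auto simp: \<F>_def)
    with maximal[of "insert x F"] that show False by auto
  qed
  with indep_I \<open>I \<subseteq> V\<close> \<open>F \<subseteq> I\<close> builds have "I \<in> fingerprinted_by F" by (auto simp: fingerprinted_by_def)
  then show thesis by (rule that)
qed

lemma many_heavy_vertices:
  assumes "G \<subseteq> [V]\<^bsup>Suc i\<^esup>" and "real (card V) \<le> N" and "4 * \<theta> * N \<le> real (card H) * \<tau> ^ Suc i"
    and sparse: "real (card G) * \<tau> ^ i \<le> \<theta> / (\<beta> * 2 ^ Suc i) * N"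
  shows "2 * (\<theta> / \<beta> * N) \<le> real (card (heavy G))"
proof -
  have "\<beta> * 2 ^ Suc i * (real (card G) * \<tau> ^ i) \<le> \<beta> * 2 ^ Suc i * (\<theta> / (\<beta> * 2 ^ Suc i) * N)"
    using sparse \<beta>_pos by (intro mult_left_mono) auto
  also have "\<dots> = \<theta> * N" using \<beta>_pos by simp
  finally have "4 * \<theta> * N \<le> \<theta> * N + \<theta> * real (card V) + \<beta> * real (card (heavy G))"
    using card_edges_le[OF assms(1)] assms(3) by linarith
  moreover have "\<theta> * real (card V) \<le> \<theta> * N" using assms(2) \<theta>_pos by simp
  ultimately have "2 * \<theta> * N \<le> \<beta> * real (card (heavy G))" by linarith
  then show ?thesis using \<beta>_pos by (simp add: field_simps)
qed

lemma light_vertices_shrunk: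
  assumes "builds F G" and "F \<subseteq> V" and card_V: "real (card V) \<le> N"
    and many_edges: "4 * \<theta> * N \<le> real (card H) * \<tau> ^ Suc i"
    and sparse: "real (card G) * \<tau> ^ i \<le> \<theta> / (\<beta> * 2 ^ Suc i) * N"
    and small_\<tau>: "(1 + \<beta>) / \<theta> * \<tau> \<le> \<theta> / \<beta>"
  shows "F \<union> (V - heavy G) \<in> shrunk V (\<theta> / \<beta> * N)"
proof -
  have "heavy G \<subseteq> V" by (auto simp: heavy_def)
  then have "card (V - heavy G) + card (heavy G) = card V"
    using finite_V by (metis card_Diff_subset card_mono finite_subset le_add_diff_inverse2)
  moreover have "real (card F) \<le> \<theta> / \<beta> * N"
  proof -
    have "real (card F) \<le> (1 + \<beta>) / \<theta> * \<tau> * real (card V)"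
      using \<open>builds F G\<close> by (rule card_fingerprint_le)
    also have "\<dots> \<le> \<theta> / \<beta> * N" using small_\<tau> card_V \<theta>_pos \<beta>_pos by (intro mult_mono) auto
    finally show ?thesis .
  qed
  moreover have "2 * (\<theta> / \<beta> * N) \<le> real (card (heavy G))"
    using many_heavy_vertices[OF builds_uniform[OF \<open>builds F G\<close>] card_V many_edges sparse] .
  ultimately show ?thesis
    using card_Un_le[of F "V - heavy G"] \<open>F \<subseteq> V\<close> by (auto simp: shrunk_def)
qed

text \<open>If the hypergraph built from the fingerprint is dense, the containers of its independent sets are
  used. Otherwise few edges of \<open>H\<close> contain a saturated set, so a positive proportion of the vertices is
  heavy, and by maximality of the fingerprint \<open>F\<close> none of them lies in \<open>I - F\<close>.\<close>

lemma fingerprinted_by_containers: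
  assumes card_V: "real (card V) \<le> N" and many_edges: "4 * \<theta> * N \<le> real (card H) * \<tau> ^ Suc i"
    and small_\<tau>: "(1 + \<beta>) / \<theta> * \<tau> \<le> \<theta> / \<beta>" and d_le: "d \<le> \<theta> / \<beta> * N" and "0 \<le> t"
    and dense_containers: "\<And>G. bounded_codegrees V G (Suc i) \<tau> (1 + \<beta>) \<Longrightarrow>
      \<theta> / (\<beta> * 2 ^ Suc i) * N \<le> real (card G) * \<tau> ^ i \<Longrightarrow>
      has_containers t i (independent_sets V G) (shrunk V d)"
  shows "has_containers t i (fingerprinted_by F) (shrunk V d)"
proof (cases "fingerprinted_by F = {}")
  case True
  then show ?thesis by (simp add: has_containers_def container_function_def)
next
  case False
  then have builds: "builds F (built F)" and "F \<subseteq> V"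
    by (auto simp: fingerprinted_by_def independent_sets_def)
  show ?thesis
  proof (cases "real (card (built F)) * \<tau> ^ i \<le> \<theta> / (\<beta> * 2 ^ Suc i) * N")
    case True
    have "F \<union> (V - heavy (built F)) \<in> shrunk V d"
      using light_vertices_shrunk[OF builds \<open>F \<subseteq> V\<close> card_V many_edges True small_\<tau>] d_le
      by (auto simp: shrunk_def)
    with \<open>0 \<le> t\<close> show ?thesis
      by (intro has_containers_single[of _ "F \<union> (V - heavy (built F))"]) (auto simp: fingerprinted_by_def)
  next
    case False
    then have "has_containers t i (independent_sets V (built F)) (shrunk V d)"
      by (intro dense_containers bounded_codegrees_builds[OF builds]) simp
    moreover have "fingerprinted_by F \<subseteq> independent_sets V (built F)"
      using builds_independent[OF builds] by (auto simp: fingerprinted_by_def)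
    ultimately show ?thesis by (rule has_containers_mono) auto
  qed
qed

lemma shrunk_containers_level:
  assumes card_V: "real (card V) \<le> N" and many_edges: "4 * \<theta> * N \<le> real (card H) * \<tau> ^ Suc i"
    and small_\<tau>: "(1 + \<beta>) / \<theta> * \<tau> \<le> \<theta> / \<beta>" and d_le: "d \<le> \<theta> / \<beta> * N"
    and t_ge: "(1 + \<beta>) / \<theta> * \<tau> * N \<le> t"
    and dense_containers: "\<And>G. bounded_codegrees V G (Suc i) \<tau> (1 + \<beta>) \<Longrightarrow>
      \<theta> / (\<beta> * 2 ^ Suc i) * N \<le> real (card G) * \<tau> ^ i \<Longrightarrow>
      has_containers t i (independent_sets V G) (shrunk V d)"
  shows "has_containers t (Suc i) (independent_sets V H) (shrunk V d)"
proof (rule has_containers_Suc)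
  fix I assume "I \<in> independent_sets V H"
  then obtain F where I_in: "I \<in> fingerprinted_by F" by (rule ex_fingerprint)
  then have "real (card F) \<le> (1 + \<beta>) / \<theta> * \<tau> * real (card V)"
    using card_fingerprint_le[of F "built F"] by (simp add: fingerprinted_by_def)
  also have "\<dots> \<le> (1 + \<beta>) / \<theta> * \<tau> * N"
    using card_V \<beta>_pos \<tau>_pos \<theta>_pos by (intro mult_left_mono) auto
  finally have "real (card F) \<le> t" using t_ge by linarith
  with I_in show "\<exists>F. F \<subseteq> I \<and> real (card F) \<le> t \<and> I \<in> fingerprinted_by F"
    by (auto simp: fingerprinted_by_def)
next
  have "0 \<le> (1 + \<beta>) / \<theta> * \<tau> * N" using card_V \<beta>_pos \<tau>_pos \<theta>_pos by simp
  then have "0 \<le> t" using t_ge by linarith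
  then show "has_containers t i (fingerprinted_by F) (shrunk V d)" for F
    using fingerprinted_by_containers[OF card_V many_edges small_\<tau> d_le _ dense_containers] by blast
qed

lemma shrunk_containers_Suc:
  assumes card_V: "real (card V) \<le> N" and many_edges: "4 * \<theta> * N \<le> real (card H) * \<tau> ^ Suc i"
    and small_\<tau>: "(1 + \<beta>) / \<theta> * \<tau> \<le> \<theta> / \<beta>"
    and dense: "\<And>G. bounded_codegrees V G (Suc i) \<tau> (1 + \<beta>) \<Longrightarrow>
      \<theta> / (\<beta> * 2 ^ Suc i) * N \<le> real (card G) * \<tau> ^ i \<Longrightarrow>
      has_containers (K * \<tau> * N) i (independent_sets V G) (shrunk V (\<delta> * N))"
  shows "has_containers (max K ((1 + \<beta>) / \<theta>) * \<tau> * N) (Suc i) (independent_sets V H)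
    (shrunk V (min \<delta> (\<theta> / \<beta>) * N))"
proof (rule shrunk_containers_level[OF card_V many_edges small_\<tau>])
  let ?t = "max K ((1 + \<beta>) / \<theta>) * \<tau> * N" and ?d = "min \<delta> (\<theta> / \<beta>) * N"
  have "0 \<le> N" using card_V by linarith
  then show "?d \<le> \<theta> / \<beta> * N" and "(1 + \<beta>) / \<theta> * \<tau> * N \<le> ?t"
    using \<tau>_pos by (intro mult_right_mono; simp)+
  have "?d \<le> \<delta> * N" and "K * \<tau> * N \<le> ?t"
    using \<open>0 \<le> N\<close> \<tau>_pos by (intro mult_right_mono; simp)+
  moreover from this(1) have "shrunk V (\<delta> * N) \<subseteq> shrunk V ?d" by (auto simp: shrunk_def)
  ultimately show "has_containers ?t i (independent_sets V G) (shrunk V ?d)"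
    if "bounded_codegrees V G (Suc i) \<tau> (1 + \<beta>)" "\<theta> / (\<beta> * 2 ^ Suc i) * N \<le> real (card G) * \<tau> ^ i" for G
    using has_containers_mono[OF dense[OF that] subset_refl] by blast
qed

end

lemma shrunk_containers_singletons:
  assumes "bounded_codegrees V H 1 \<tau> \<beta>" and "\<alpha> * N \<le> real (card H)" and "0 \<le> t"
  shows "has_containers t m (independent_sets V H) (shrunk V (\<alpha> * N))"
proof -
  interpret bounded_codegrees V H 1 \<tau> \<beta> by fact
  define U where "U = {x. {x} \<in> H}"
  have "U \<subseteq> V" using uniform by (auto simp: U_def nsets_def)
  have "H = (\<lambda>x. {x}) ` U" using uniform by (auto simp: U_def nsets_one)
  then have "card H = card U" by (simp add: card_image)
  then have "real (card (V - U)) + real (card H) = real (card V)"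
    using finite_V \<open>U \<subseteq> V\<close> card_mono[OF finite_V, of U] by (simp add: card_Diff_subset finite_subset)
  with assms(2) have "V - U \<in> shrunk V (\<alpha> * N)" by (auto simp: shrunk_def)
  moreover have "I \<subseteq> V - U" if "I \<in> independent_sets V H" for I
    using that by (auto simp: independent_sets_def U_def)
  ultimately show ?thesis using assms(3) by (intro has_containers_single) auto
qed

lemma shrunk_containers:
  assumes "0 < \<alpha>" and "0 < \<beta>"
  shows "\<exists>\<delta>>0. \<exists>K>0. \<exists>\<tau>\<^sub>0>0. \<forall>(V::'a set) H N \<tau>.
    bounded_codegrees V H (Suc i) \<tau> \<beta> \<longrightarrow> real (card V) \<le> N \<longrightarrow> \<tau> \<le> \<tau>\<^sub>0 \<longrightarrow>
    \<alpha> * N \<le> real (card H) * \<tau> ^ i \<longrightarrow>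
    has_containers (K * \<tau> * N) i (independent_sets V H) (shrunk V (\<delta> * N))"
  using assms
proof (induction i arbitrary: \<alpha> \<beta>)
  case 0
  have "has_containers (1 * \<tau> * N) 0 (independent_sets V H) (shrunk V (\<alpha> * N))"
    if "bounded_codegrees V H (Suc 0) \<tau> \<beta>" "real (card V) \<le> N" "\<alpha> * N \<le> real (card H) * \<tau> ^ 0"
    for V :: "'a set" and H N \<tau>
    using that bounded_codegrees.\<tau>_pos[OF that(1)]
    by (intro shrunk_containers_singletons mult_nonneg_nonneg) (auto intro: order_trans[rotated])
  with \<open>0 < \<alpha>\<close> show ?case by (metis zero_less_one)
next
  case (Suc i)
  define \<theta> where "\<theta> = \<alpha> / 4"
  have "0 < \<theta>" "0 < \<theta> / (\<beta> * 2 ^ Suc i)" "0 < 1 + \<beta>" using Suc.prems by (auto simp: \<theta>_def)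
  from Suc.IH[OF this(2,3)] obtain \<delta> K \<tau>\<^sub>0 where "0 < \<delta>" "0 < K" "0 < \<tau>\<^sub>0"
    and IH: "\<And>(V::'a set) H N \<tau>. bounded_codegrees V H (Suc i) \<tau> (1 + \<beta>) \<Longrightarrow> real (card V) \<le> N \<Longrightarrow>
      \<tau> \<le> \<tau>\<^sub>0 \<Longrightarrow> \<theta> / (\<beta> * 2 ^ Suc i) * N \<le> real (card H) * \<tau> ^ i \<Longrightarrow>
      has_containers (K * \<tau> * N) i (independent_sets V H) (shrunk V (\<delta> * N))"
    by blast
  let ?\<delta> = "min \<delta> (\<theta> / \<beta>)" and ?K = "max K ((1 + \<beta>) / \<theta>)"
    and ?\<tau>\<^sub>0 = "min \<tau>\<^sub>0 (\<theta> / \<beta> / ((1 + \<beta>) / \<theta>))"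
  have "has_containers (?K * \<tau> * N) (Suc i) (independent_sets V H) (shrunk V (?\<delta> * N))"
    if codegrees: "bounded_codegrees V H (Suc (Suc i)) \<tau> \<beta>" and card_V: "real (card V) \<le> N"
      and "\<tau> \<le> ?\<tau>\<^sub>0" and "\<alpha> * N \<le> real (card H) * \<tau> ^ Suc i" for V :: "'a set" and H N \<tau>
  proof -
    interpret bounded_codegrees V H "Suc (Suc i)" \<tau> \<beta> by (rule codegrees)
    interpret container_level V H i \<tau> \<beta> \<theta> by unfold_locales (fact \<open>0 < \<beta>\<close>, fact \<open>0 < \<theta>\<close>)
    have "4 * \<theta> * N \<le> real (card H) * \<tau> ^ Suc i" using that(4) by (simp add: \<theta>_def)
    moreover have "(1 + \<beta>) / \<theta> * \<tau> \<le> \<theta> / \<beta>"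
      using \<open>\<tau> \<le> ?\<tau>\<^sub>0\<close> \<open>0 < \<theta>\<close> \<open>0 < 1 + \<beta>\<close> pos_le_divide_eq[of "(1 + \<beta>) / \<theta>" \<tau> "\<theta> / \<beta>"]
      by (simp add: mult.commute)
    ultimately show ?thesis
      using \<open>\<tau> \<le> ?\<tau>\<^sub>0\<close> by (intro shrunk_containers_Suc[OF card_V] IH[OF _ card_V]) simp_all
  qed
  moreover have "0 < ?\<delta>" "0 < ?K" "0 < ?\<tau>\<^sub>0"
    using \<open>0 < \<delta>\<close> \<open>0 < K\<close> \<open>0 < \<tau>\<^sub>0\<close> \<open>0 < \<theta>\<close> \<open>0 < \<beta>\<close> by auto
  ultimately show ?case
    by (intro exI[of _ ?\<delta>] exI[of _ ?K] exI[of _ ?\<tau>\<^sub>0] conjI allI impI) assumption+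
qed

theorem hypergraph_containers:
  assumes "0 < \<alpha>" and "0 < \<beta>"
  shows "\<exists>m. \<exists>K>0. \<exists>\<tau>\<^sub>0>0. \<forall>(V::'a set) H N \<tau>.
    bounded_codegrees V H (Suc i) \<tau> \<beta> \<longrightarrow> real (card V) \<le> N \<longrightarrow> 0 < N \<longrightarrow> \<tau> \<le> \<tau>\<^sub>0 \<longrightarrow>
    has_containers (K * \<tau> * N) m (independent_sets V H)
      {C. C \<subseteq> V \<and> real (card (H \<inter> Pow C)) * \<tau> ^ i < \<alpha> * N}"
proof -
  from shrunk_containers[OF assms] obtain \<delta> K \<tau>\<^sub>0 where pos: "0 < \<delta>" "0 < K" "0 < \<tau>\<^sub>0"
    and shrink: "\<And>(V::'a set) H N \<tau>. bounded_codegrees V H (Suc i) \<tau> \<beta> \<Longrightarrow> real (card V) \<le> N \<Longrightarrow>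
      \<tau> \<le> \<tau>\<^sub>0 \<Longrightarrow> \<alpha> * N \<le> real (card H) * \<tau> ^ i \<Longrightarrow>
      has_containers (K * \<tau> * N) i (independent_sets V H) (shrunk V (\<delta> * N))"
    by blast
  obtain j where "1 / \<delta> < real j" using reals_Archimedean2 by blast
  then have j_large: "1 < real j * \<delta>" using pos(1) by (simp add: field_simps)
  have "has_containers (K * \<tau> * N) (j * i) (independent_sets V H)
      {C. C \<subseteq> V \<and> real (card (H \<inter> Pow C)) * \<tau> ^ i < \<alpha> * N}"
    if codegrees: "bounded_codegrees V H (Suc i) \<tau> \<beta>" and card_V: "real (card V) \<le> N"
      and "0 < N" and "\<tau> \<le> \<tau>\<^sub>0" for V :: "'a set" and H N \<tau>
  proof -
    interpret bounded_codegrees V H "Suc i" \<tau> \<beta> by (rule codegrees)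
    let ?sparse = "{C. real (card (H \<inter> Pow C)) * \<tau> ^ i < \<alpha> * N}"
    have "has_containers (K * \<tau> * N) (j * i) (independent_sets V H) (?sparse \<inter> Pow V)"
    proof (rule has_containers_by_shrinking)
      fix C assume "C \<subseteq> V" "C \<notin> ?sparse"
      then have "has_containers (K * \<tau> * N) i (independent_sets C (H \<inter> Pow C)) (shrunk C (\<delta> * N))"
        using card_mono[OF finite_V \<open>C \<subseteq> V\<close>] card_V \<open>\<tau> \<le> \<tau>\<^sub>0\<close>
        by (intro shrink bounded_codegrees_restrict) auto
      moreover have "independent_sets V H \<inter> Pow C \<subseteq> independent_sets C (H \<inter> Pow C)"
        by (auto simp: independent_sets_def)
      ultimately show "has_containers (K * \<tau> * N) i (independent_sets V H \<inter> Pow C) (shrunk C (\<delta> * N))"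
        by (rule has_containers_mono) auto
    next
      have "1 * N < real j * \<delta> * N" using j_large \<open>0 < N\<close> by (rule mult_strict_right_mono)
      with card_V show "real (card V) < real j * (\<delta> * N)" unfolding mult.assoc by linarith
    qed (use pos \<open>0 < N\<close> \<tau>_pos in \<open>auto simp: independent_sets_def\<close>)
    then show ?thesis by (rule has_containers_mono) auto
  qed
  with pos show ?thesis by blast
qed

section \<open>Cliques and anticliques\<close>

definition cliques :: "'a set \<Rightarrow> nat \<Rightarrow> 'a set set \<Rightarrow> 'a set set" where
  "cliques V r E = {W \<in> [V]\<^bsup>r\<^esup>. clique W E}"

definition anticliques :: "'a set \<Rightarrow> nat \<Rightarrow> 'a set set \<Rightarrow> 'a set set" where
  "anticliques V s E = {W \<in> [V]\<^bsup>s\<^esup>. indep W E}"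

definition clique_free :: "'a set \<Rightarrow> nat \<Rightarrow> 'a set set set" where
  "clique_free V r = {B. B \<subseteq> [V]\<^bsup>2\<^esup> \<and> cliques V r B = {}}"

definition clique_hypergraph :: "'a set \<Rightarrow> nat \<Rightarrow> 'a set set set" where
  "clique_hypergraph V r = (\<lambda>W. [W]\<^bsup>2\<^esup>) ` [V]\<^bsup>r\<^esup>"

lemma clique_iff_nsets: "clique W E \<longleftrightarrow> [W]\<^bsup>2\<^esup> \<subseteq> E"
  by (auto simp: clique_def elim!: nsets2_E)

lemma indep_iff_nsets: "indep W E \<longleftrightarrow> [W]\<^bsup>2\<^esup> \<inter> E = {}"
  by (auto simp: indep_def disjoint_iff elim!: nsets2_E)

lemma Union_nsets_2:
  assumes "2 \<le> card W"
  shows "\<Union>([W]\<^bsup>2\<^esup>) = W"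
proof
  show "W \<subseteq> \<Union>([W]\<^bsup>2\<^esup>)"
  proof
    fix x assume "x \<in> W"
    moreover have "W \<noteq> {x}" using assms by auto
    ultimately obtain y where "y \<in> W" "y \<noteq> x" by auto
    with \<open>x \<in> W\<close> have "{x, y} \<in> [W]\<^bsup>2\<^esup>" by simp
    then show "x \<in> \<Union>([W]\<^bsup>2\<^esup>)" by blast
  qed
qed (auto simp: nsets_def)

lemma Union_subset_nsets_2: "S \<subseteq> [W]\<^bsup>2\<^esup> \<Longrightarrow> \<Union>S \<subseteq> W"
  by (auto simp: nsets_def)

lemma card_Union_edges_ge_2:
  assumes "S \<subseteq> [W]\<^bsup>2\<^esup>" and "S \<noteq> {}" and "finite (\<Union>S)"
  shows "2 \<le> card (\<Union>S)"
proof -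
  obtain e where "e \<in> S" using assms(2) by blast
  then have "e \<subseteq> \<Union>S" "card e = 2" using assms(1) by (auto simp: nsets_def)
  then show ?thesis using card_mono[OF assms(3)] by metis
qed

lemma card_edges_le_choose_Union:
  assumes "S \<subseteq> [W]\<^bsup>2\<^esup>" and "finite (\<Union>S)"
  shows "card S \<le> card (\<Union>S) choose 2"
proof -
  have "S \<subseteq> [\<Union>S]\<^bsup>2\<^esup>" using assms(1) by (auto simp: nsets_def)
  then show ?thesis using card_mono[OF finite_imp_finite_nsets[OF assms(2)]] by simp
qed

lemma binomial_le_power: "n choose r \<le> n ^ r"
  by (cases "r \<le> n") (auto simp: binomial_le_pow binomial_eq_0)

lemma card_nsets_supersets_le:
  assumes "finite V" and "finite U"
  shows "card {W \<in> [V]\<^bsup>r\<^esup>. U \<subseteq> W} \<le> card V ^ (r - card U)"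
proof -
  have "card {W \<in> [V]\<^bsup>r\<^esup>. U \<subseteq> W} \<le> card (nsets V (r - card U))"
  proof (rule card_inj_on_le[of "\<lambda>W. W - U"])
    show "inj_on (\<lambda>W. W - U) {W \<in> [V]\<^bsup>r\<^esup>. U \<subseteq> W}"
      by (rule inj_onI) (auto; blast)
    show "(\<lambda>W. W - U) ` {W \<in> [V]\<^bsup>r\<^esup>. U \<subseteq> W} \<subseteq> nsets V (r - card U)"
      using assms(2) by (auto simp: nsets_def card_Diff_subset)
  qed (rule finite_imp_finite_nsets[OF assms(1)])
  also have "\<dots> \<le> card V ^ (r - card U)" by (simp add: binomial_le_power)
  finally show ?thesis .
qed

lemma codegree_clique_hypergraph_le:
  assumes "finite V" and "finite (\<Union>S)"
  shows "codegree (clique_hypergraph V r) S \<le> card V ^ (r - card (\<Union>S))"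
proof -
  have "{h \<in> clique_hypergraph V r. S \<subseteq> h} \<subseteq> (\<lambda>W. [W]\<^bsup>2\<^esup>) ` {W \<in> [V]\<^bsup>r\<^esup>. \<Union>S \<subseteq> W}"
    by (auto simp: clique_hypergraph_def nsets_def intro!: imageI)
  moreover have "finite {W \<in> [V]\<^bsup>r\<^esup>. \<Union>S \<subseteq> W}" using assms(1) by (simp add: finite_imp_finite_nsets)
  ultimately have "codegree (clique_hypergraph V r) S \<le> card {W \<in> [V]\<^bsup>r\<^esup>. \<Union>S \<subseteq> W}"
    unfolding codegree_def by (rule surj_card_le[rotated])
  also have "\<dots> \<le> card V ^ (r - card (\<Union>S))" using assms by (rule card_nsets_supersets_le)
  finally show ?thesis .
qed

lemma clique_hypergraph_codegree_bound:
  assumes "finite V" and "V \<noteq> {}" and "0 \<le> a"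
    and balanced: "\<And>u. 2 \<le> u \<Longrightarrow> u \<le> r \<Longrightarrow>
      real r - real u \<le> a * (real (r choose 2) - real (u choose 2))"
    and "S \<noteq> {}" and S_edges: "S \<subseteq> [W]\<^bsup>2\<^esup>" and W_nset: "W \<in> [V]\<^bsup>r\<^esup>"
  shows "real (codegree (clique_hypergraph V r) S) * (real (card V) powr - a) ^ ((r choose 2) - card S) \<le> 1"
proof -
  let ?n = "real (card V)" and ?U = "\<Union>S"
  have n_ge_1: "1 \<le> ?n" using \<open>finite V\<close> \<open>V \<noteq> {}\<close> by (simp add: Suc_leI card_gt_0_iff)
  have "finite W" "card W = r" using W_nset by (auto simp: nsets_def)
  with S_edges have "finite ?U" "card ?U \<le> r"
    using Union_subset_nsets_2[of S W] by (auto simp: card_mono finite_subset)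
  have "2 \<le> card ?U" "card S \<le> card ?U choose 2"
    using card_Union_edges_ge_2 card_edges_le_choose_Union S_edges \<open>S \<noteq> {}\<close> \<open>finite ?U\<close> by blast+
  then have "real (r choose 2) - real (card ?U choose 2) \<le> real ((r choose 2) - card S)"
    by linarith
  then have exponent: "real r - real (card ?U) \<le> a * real ((r choose 2) - card S)"
    using balanced[OF \<open>2 \<le> card ?U\<close> \<open>card ?U \<le> r\<close>] \<open>0 \<le> a\<close> by (meson mult_left_mono order_trans)
  have "real (codegree (clique_hypergraph V r) S) \<le> ?n ^ (r - card ?U)"
    using codegree_clique_hypergraph_le[OF \<open>finite V\<close> \<open>finite ?U\<close>] by (simp flip: of_nat_power)
  also have "\<dots> = ?n powr (real r - real (card ?U))"
    using n_ge_1 \<open>card ?U \<le> r\<close> by (simp flip: powr_realpow add: of_nat_diff)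
  finally have "real (codegree (clique_hypergraph V r) S) * (?n powr - a) ^ ((r choose 2) - card S)
      \<le> ?n powr (real r - real (card ?U)) * (?n powr - a) ^ ((r choose 2) - card S)"
    by (intro mult_right_mono) auto
  also have "\<dots> = ?n powr (real r - real (card ?U) - a * real ((r choose 2) - card S))"
    using n_ge_1 by (simp add: powr_power mult.commute flip: powr_add)
  also have "\<dots> \<le> ?n powr 0" using exponent n_ge_1 by (intro powr_mono) auto
  finally show ?thesis using n_ge_1 by simp
qed

lemma bounded_codegrees_clique_hypergraph:
  assumes "finite V" and "V \<noteq> {}" and "0 \<le> a"
    and "\<And>u. 2 \<le> u \<Longrightarrow> u \<le> r \<Longrightarrow> real r - real u \<le> a * (real (r choose 2) - real (u choose 2))"
  shows "bounded_codegrees ([V]\<^bsup>2\<^esup>) (clique_hypergraph V r) (r choose 2) (real (card V) powr - a) 1"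
proof
  show "clique_hypergraph V r \<subseteq> nsets ([V]\<^bsup>2\<^esup>) (r choose 2)"
    by (auto simp: clique_hypergraph_def nsets_def[of _ r] nsets_def[of _ "r choose 2"]
        finite_imp_finite_nsets intro: nsets_mono[THEN subsetD])
  fix S :: "'a set set" assume "S \<noteq> {}"
  show "real (codegree (clique_hypergraph V r) S) * (real (card V) powr - a) ^ ((r choose 2) - card S) \<le> 1"
  proof (cases "\<exists>W\<in>[V]\<^bsup>r\<^esup>. S \<subseteq> [W]\<^bsup>2\<^esup>")
    case True
    with clique_hypergraph_codegree_bound[OF assms \<open>S \<noteq> {}\<close>] show ?thesis by blast
  next
    case False
    then have "codegree (clique_hypergraph V r) S = 0"
      by (intro codegree_eq_0) (auto simp: clique_hypergraph_def)
    then show ?thesis by simp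
  qed
qed (use assms in \<open>auto simp: finite_imp_finite_nsets\<close>)

section \<open>The maximum 2-density of complete graphs\<close>

lemma complete_graph_eq_nsets: "complete_graph r = ({..<r}, [{..<r}]\<^bsup>2\<^esup>)"
  by (auto simp: complete_hypergraph_def nsets_def finite_subset)

lemma finite_subhypergraphs:
  assumes "finite (verts F)" and "finite (edges F)"
  shows "finite {J. subhypergraph J F}"
proof (rule finite_subset)
  show "{J. subhypergraph J F} \<subseteq> Pow (verts F) \<times> Pow (edges F)"
    by (auto simp: subhypergraph_def)
qed (use assms in simp)

lemma real_choose_two: "real (v choose 2) = real v * (real v - 1) / 2"
  by (cases v) (simp_all add: choose_two real_of_nat_div algebra_simps)

lemma two_density_complete: "3 \<le> v \<Longrightarrow> (real (v choose 2) - 1) / (real v - 2) = (real v + 1) / 2"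
  by (simp add: real_choose_two field_simps)

lemma two_density_subgraph_complete_le:
  assumes "subhypergraph J (complete_graph r)" and "3 \<le> card (verts J)"
  shows "(real (card (edges J)) - 1) / (real (card (verts J)) - 2) \<le> (real r + 1) / 2"
proof -
  let ?v = "card (verts J)"
  have verts_J: "verts J \<subseteq> {..<r}" and edges_J: "edges J \<subseteq> [verts J]\<^bsup>2\<^esup>"
    using assms(1) by (auto simp: subhypergraph_def complete_graph_eq_nsets nsets_def)
  have "finite (verts J)" using verts_J finite_subset by auto
  then have "card (edges J) \<le> ?v choose 2"
    using card_mono[OF finite_imp_finite_nsets edges_J] by simp
  then have "(real (card (edges J)) - 1) / (real ?v - 2) \<le> (real (?v choose 2) - 1) / (real ?v - 2)"
    using assms(2) by (intro divide_right_mono) auto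
  also have "\<dots> = (real ?v + 1) / 2" using assms(2) by (rule two_density_complete)
  also have "\<dots> \<le> (real r + 1) / 2" using card_mono[OF _ verts_J] by simp
  finally show ?thesis .
qed

lemma max_2_density_complete_graph:
  assumes "3 \<le> r"
  shows "max_2_density (complete_graph r) = (real r + 1) / 2"
proof -
  let ?density = "\<lambda>J::nat hypergraph. (real (card (edges J)) - 1) / (real (card (verts J)) - 2)"
  let ?D = "{?density J | J. subhypergraph J (complete_graph r) \<and> card (verts J) \<ge> 3}"
  have "Max ?D = (real r + 1) / 2"
  proof (rule Max_eqI)
    have "finite (?density ` {J. subhypergraph J (complete_graph r)})"
      by (intro finite_imageI finite_subhypergraphs)
        (simp_all add: complete_graph_eq_nsets finite_imp_finite_nsets)
    then show "finite ?D" by (rule rev_finite_subset) blast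
    show "y \<le> (real r + 1) / 2" if "y \<in> ?D" for y
      using that two_density_subgraph_complete_le by auto
    have "subhypergraph (complete_graph r) (complete_graph r)"
      by (auto simp: subhypergraph_def complete_hypergraph_def)
    moreover have "?density (complete_graph r) = (real r + 1) / 2"
      using two_density_complete[OF assms] by (simp add: complete_graph_eq_nsets)
    ultimately show "(real r + 1) / 2 \<in> ?D"
      using assms by (intro CollectI exI[of _ "complete_graph r"]) (simp add: complete_hypergraph_def)
  qed
  with assms show ?thesis by (simp add: max_2_density_def complete_hypergraph_def)
qed

lemma inverse_max_2_density_complete_graph:
  assumes "2 \<le> r"
  shows "1 / max_2_density (complete_graph r) = (if r = 2 then 1 else 2 / (real r + 1))"
proof (cases "r = 2")
  case True
  then show ?thesis by (simp add: max_2_density_def complete_hypergraph_def)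
next
  case False
  with assms show ?thesis by (simp add: max_2_density_complete_graph)
qed

lemma
  fixes a :: real
  assumes "2 \<le> r" and a_inverse: "a = 1 / max_2_density (complete_graph r)"
  shows inverse_max_2_density_pos: "0 < a"
    and inverse_max_2_density_le_1: "a \<le> 1"
    and inverse_max_2_density_mult: "a * (real (r choose 2) - 1) = real r - 2"
    and inverse_max_2_density_balanced: "\<And>u. 2 \<le> u \<Longrightarrow> u \<le> r \<Longrightarrow>
      real r - real u \<le> a * (real (r choose 2) - real (u choose 2))"
proof -
  have a_eq: "a = (if r = 2 then 1 else 2 / (real r + 1))"
    unfolding a_inverse using \<open>2 \<le> r\<close> by (rule inverse_max_2_density_complete_graph)
  show "0 < a" "a \<le> 1" using a_eq \<open>2 \<le> r\<close> by (auto simp: field_simps)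
  have choose_diff: "a * (real (r choose 2) - real (u choose 2))
      = (real r - real u) * (real r + real u - 1) / (real r + 1)"
    if "r \<noteq> 2" for u
    using that \<open>2 \<le> r\<close> by (simp add: a_eq real_choose_two field_simps)
  show "a * (real (r choose 2) - 1) = real r - 2"
  proof (cases "r = 2")
    case False
    moreover have "real r + 1 \<noteq> 0" by linarith
    ultimately show ?thesis using choose_diff[of 2] by (simp add: add.commute)
  qed (simp add: a_eq)
  fix u assume u_bounds: "2 \<le> u" "u \<le> r"
  show "real r - real u \<le> a * (real (r choose 2) - real (u choose 2))"
  proof (cases "r = 2")
    case False
    have "(real r - real u) * (real r + 1) \<le> (real r - real u) * (real r + real u - 1)"
      using u_bounds by (intro mult_left_mono) auto
    then show ?thesis using choose_diff[OF False, of u] by (simp add: le_divide_eq)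
  qed (use u_bounds in auto)
qed

section \<open>Containers for clique-free graphs\<close>

lemma clique_free_eq_independent_sets: "clique_free V r = independent_sets ([V]\<^bsup>2\<^esup>) (clique_hypergraph V r)"
  by (auto simp: clique_free_def independent_sets_def clique_hypergraph_def cliques_def clique_iff_nsets)

lemma card_clique_hypergraph_Int_Pow:
  assumes "2 \<le> r"
  shows "card (clique_hypergraph V r \<inter> Pow E) = card (cliques V r E)"
proof -
  have "clique_hypergraph V r \<inter> Pow E = (\<lambda>W. [W]\<^bsup>2\<^esup>) ` cliques V r E"
    by (auto simp: clique_hypergraph_def cliques_def clique_iff_nsets)
  moreover have "inj_on (\<lambda>W. [W]\<^bsup>2\<^esup>) (cliques V r E)"
    by (rule inj_on_inverseI[of _ Union])
      (use assms in \<open>auto simp: cliques_def nsets_def[of _ r] Union_nsets_2\<close>)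
  ultimately show ?thesis by (simp add: card_image)
qed

lemma card_cliques_le_if_sparse:
  assumes "2 \<le> r" and choose_l: "r choose 2 = Suc l" and exponent: "a * real l = real r - 2" and "0 < n"
    and sparse: "real (card (clique_hypergraph V r \<inter> Pow C)) * (real n powr - a) ^ l < \<alpha> * real n ^ 2"
  shows "real (card (cliques V r C)) \<le> \<alpha> * real n ^ r"
proof -
  let ?\<tau> = "real n powr - a"
  have "?\<tau> ^ l * real n ^ r = real n powr (- (a * real l)) * real n powr real r"
    using \<open>0 < n\<close> by (simp add: powr_realpow powr_power mult.commute)
  also have "\<dots> = real n powr (- (a * real l) + real r)" by (rule powr_add[symmetric])
  also have "- (a * real l) + real r = 2" using exponent by simp
  finally have "?\<tau> ^ l * real n ^ r = real n ^ 2" using \<open>0 < n\<close> by simp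
  then have "real (card (cliques V r C)) * ?\<tau> ^ l \<le> \<alpha> * real n ^ r * ?\<tau> ^ l"
    using sparse by (simp add: card_clique_hypergraph_Int_Pow[OF \<open>2 \<le> r\<close>] mult_ac)
  then show ?thesis using \<open>0 < n\<close> by simp
qed

lemma clique_free_containers_if_sparse:
  assumes "2 \<le> r" and choose_l: "r choose 2 = Suc l" and exponent: "a * real l = real r - 2" and "0 < n"
    and sparse: "has_containers (K * real n powr - a * real n ^ 2) m
      (independent_sets ([V]\<^bsup>2\<^esup>) (clique_hypergraph V r)) {C. C \<subseteq> [V]\<^bsup>2\<^esup> \<and>
        real (card (clique_hypergraph V r \<inter> Pow C)) * (real n powr - a) ^ l < \<alpha> * real n ^ 2}"
  shows "has_containers (K * real n powr (2 - a)) m (clique_free V r)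
    {C. real (card (cliques V r C)) \<le> \<alpha> * real n ^ r}"
proof -
  have "K * real n powr - a * real n ^ 2 = K * real n powr (2 - a)"
    using powr_add[of "real n" 2 "- a"] \<open>0 < n\<close> by simp
  with sparse show ?thesis
    using card_cliques_le_if_sparse[OF \<open>2 \<le> r\<close> choose_l exponent \<open>0 < n\<close>]
    by (auto simp: clique_free_eq_independent_sets elim!: has_containers_mono)
qed

lemma clique_free_containers:
  assumes "2 \<le> r" and "0 < \<alpha>" and a_inverse: "a = 1 / max_2_density (complete_graph r)"
  shows "\<exists>m. \<exists>K>0. \<forall>\<^sub>F n in sequentially. \<forall>V::'a set. card V = n \<longrightarrow>
    has_containers (K * real n powr (2 - a)) m (clique_free V r)
      {C. real (card (cliques V r C)) \<le> \<alpha> * real n ^ r}"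
proof -
  note a_pos = inverse_max_2_density_pos[OF \<open>2 \<le> r\<close> a_inverse]
    and a_mult = inverse_max_2_density_mult[OF \<open>2 \<le> r\<close> a_inverse]
    and balanced = inverse_max_2_density_balanced[OF \<open>2 \<le> r\<close> a_inverse]
  obtain l where choose_l: "r choose 2 = Suc l"
    using \<open>2 \<le> r\<close> by (metis not0_implies_Suc binomial_eq_0_iff not_le)
  from hypergraph_containers[OF \<open>0 < \<alpha>\<close> zero_less_one, of l]
  obtain m K \<tau>\<^sub>0 where "0 < K" "0 < \<tau>\<^sub>0" and general_containers:
    "\<And>(V::'a set set) H N \<tau>. bounded_codegrees V H (Suc l) \<tau> 1 \<Longrightarrow> real (card V) \<le> N \<Longrightarrow>
      0 < N \<Longrightarrow> \<tau> \<le> \<tau>\<^sub>0 \<Longrightarrow> has_containers (K * \<tau> * N) m (independent_sets V H)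
        {C. C \<subseteq> V \<and> real (card (H \<inter> Pow C)) * \<tau> ^ l < \<alpha> * N}"
    by blast
  have "((\<lambda>n. real n powr - a) \<longlongrightarrow> 0) sequentially"
    by (intro tendsto_neg_powr filterlim_real_sequentially) (use a_pos in simp)
  then have "\<forall>\<^sub>F n in sequentially. real n powr - a < \<tau>\<^sub>0" using \<open>0 < \<tau>\<^sub>0\<close> by (rule order_tendstoD)
  then have "\<forall>\<^sub>F n in sequentially. \<forall>V::'a set. card V = n \<longrightarrow>
      has_containers (K * real n powr (2 - a)) m (clique_free V r)
        {C. real (card (cliques V r C)) \<le> \<alpha> * real n ^ r}"
    using eventually_gt_at_top[of 0]
  proof (eventually_elim, intro allI impI)
    fix n and V :: "'a set"
    assume small: "real n powr - a < \<tau>\<^sub>0" and "0 < n" and card_V: "card V = n"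
    then have "finite V" "V \<noteq> {}" by (auto simp: card_gt_0_iff)
    have "bounded_codegrees ([V]\<^bsup>2\<^esup>) (clique_hypergraph V r) (Suc l) (real n powr - a) 1"
      using bounded_codegrees_clique_hypergraph[OF \<open>finite V\<close> \<open>V \<noteq> {}\<close> _ balanced] a_pos
      by (simp add: card_V choose_l)
    moreover have "real (card ([V]\<^bsup>2\<^esup>)) \<le> real n ^ 2"
      using binomial_le_power[of n 2] by (simp add: card_V flip: of_nat_power)
    moreover have "a * real l = real r - 2" using a_mult choose_l by simp
    ultimately show "has_containers (K * real n powr (2 - a)) m (clique_free V r)
        {C. real (card (cliques V r C)) \<le> \<alpha> * real n ^ r}"
      using small \<open>0 < n\<close>
      by (intro clique_free_containers_if_sparse[OF \<open>2 \<le> r\<close> choose_l] general_containers) auto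
  qed
  with \<open>0 < K\<close> show ?thesis by blast
qed

lemma card_nsets_containing_le:
  assumes "finite V" and "\<X> \<subseteq> [V]\<^bsup>r\<^esup>"
  shows "card {Z \<in> [V]\<^bsup>R\<^esup>. \<exists>W\<in>\<X>. W \<subseteq> Z} \<le> card \<X> * card V ^ (R - r)"
proof -
  have "{Z \<in> [V]\<^bsup>R\<^esup>. \<exists>W\<in>\<X>. W \<subseteq> Z} = (\<Union>W\<in>\<X>. {Z \<in> [V]\<^bsup>R\<^esup>. W \<subseteq> Z})" by auto
  also have "card \<dots> \<le> (\<Sum>W\<in>\<X>. card {Z \<in> [V]\<^bsup>R\<^esup>. W \<subseteq> Z})"
    using assms by (intro card_UN_le finite_uniform)
  also have "\<dots> \<le> (\<Sum>W\<in>\<X>. card V ^ (R - r))"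
  proof (rule sum_mono)
    fix W assume "W \<in> \<X>"
    then have "finite W" "card W = r" using assms(2) by (auto simp: nsets_def)
    with assms(1) show "card {Z \<in> [V]\<^bsup>R\<^esup>. W \<subseteq> Z} \<le> card V ^ (R - r)"
      using card_nsets_supersets_le by blast
  qed
  finally show ?thesis by simp
qed

lemma binomial_le_cliques_anticliques:
  assumes "finite V"
    and ramsey: "\<And>Z. Z \<in> [V]\<^bsup>R\<^esup> \<Longrightarrow> \<exists>W\<subseteq>Z. card W = r \<and> clique W E \<or> card W = s \<and> indep W E"
  shows "card V choose R
    \<le> card (cliques V r E) * card V ^ (R - r) + card (anticliques V s E) * card V ^ (R - s)"
proof -
  let ?containing = "\<lambda>\<X>. {Z \<in> [V]\<^bsup>R\<^esup>. \<exists>W\<in>\<X>. W \<subseteq> Z}"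
  have "Z \<in> ?containing (cliques V r E) \<union> ?containing (anticliques V s E)" if Z_nset: "Z \<in> [V]\<^bsup>R\<^esup>" for Z
  proof -
    obtain W where W_sub: "W \<subseteq> Z" and "card W = r \<and> clique W E \<or> card W = s \<and> indep W E"
      using ramsey[OF Z_nset] by blast
    moreover from this have "W \<subseteq> V" "finite W" using Z_nset finite_subset by (auto simp: nsets_def)
    ultimately have "W \<in> cliques V r E \<or> W \<in> anticliques V s E"
      by (auto simp: cliques_def anticliques_def nsets_def)
    with W_sub Z_nset show ?thesis by blast
  qed
  then have "[V]\<^bsup>R\<^esup> = ?containing (cliques V r E) \<union> ?containing (anticliques V s E)" by blast
  from arg_cong[OF this, of card]
  have "card V choose R \<le> card (?containing (cliques V r E)) + card (?containing (anticliques V s E))"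
    unfolding card_nsets by (simp only: card_Un_le)
  also have "\<dots> \<le> card (cliques V r E) * card V ^ (R - r) + card (anticliques V s E) * card V ^ (R - s)"
    using assms(1) by (intro add_mono card_nsets_containing_le) (auto simp: cliques_def anticliques_def)
  finally show ?thesis .
qed

lemma few_cliques_imp_many_anticliques:
  "\<exists>c>0. \<forall>\<^sub>F n in sequentially. \<forall>(V::'a set) E. card V = n \<longrightarrow>
    real (card (cliques V r E)) \<le> c * real n ^ r \<longrightarrow> c * real n ^ s \<le> real (card (anticliques V s E))"
proof -
  obtain R\<^sub>0 where ramsey: "\<And>(Z::'a set) E. finite Z \<Longrightarrow> R\<^sub>0 \<le> card Z \<Longrightarrow>
      \<exists>W\<subseteq>Z. card W = r \<and> clique W E \<or> card W = s \<and> indep W E"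
    using ramsey2[of r s, where ?'a = 'a] by auto
  define R where "R = max R\<^sub>0 (max r s)"
  define c where "c = 1 / (2 * real R ^ R)"
  have "0 < real R ^ R" by (cases R) auto
  then have "0 < c" by (simp add: c_def)
  have "\<forall>\<^sub>F n in sequentially. \<forall>(V::'a set) E. card V = n \<longrightarrow>
      real (card (cliques V r E)) \<le> c * real n ^ r \<longrightarrow> c * real n ^ s \<le> real (card (anticliques V s E))"
    using eventually_gt_at_top[of R]
  proof (eventually_elim, intro allI impI)
    fix n E and V :: "'a set"
    assume "R < n" and card_V: "card V = n" and few: "real (card (cliques V r E)) \<le> c * real n ^ r"
    have split_power: "real n ^ R = real n ^ j * real n ^ (R - j)" if "j \<le> R" for j
      using that by (simp flip: power_add)
    have "finite V" using card_V \<open>R < n\<close> by (intro card_ge_0_finite) simp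
    have "2 * (c * real n ^ R) \<le> real (n choose R)"
      using binomial_ge_n_over_k_pow_k[of R n, where ?'a = real] \<open>R < n\<close> by (simp add: c_def power_divide)
    also have "n choose R \<le> card (cliques V r E) * n ^ (R - r) + card (anticliques V s E) * n ^ (R - s)"
      using binomial_le_cliques_anticliques[OF \<open>finite V\<close>, of R r E s] ramsey
      by (simp add: card_V nsets_def R_def)
    finally have "2 * (c * real n ^ R) \<le> real (card (cliques V r E)) * real n ^ (R - r)
        + real (card (anticliques V s E)) * real n ^ (R - s)"
      by simp
    moreover have "real (card (cliques V r E)) * real n ^ (R - r) \<le> c * real n ^ R"
      using mult_right_mono[OF few, of "real n ^ (R - r)"] split_power[of r] by (simp add: R_def mult.assoc)
    ultimately have "c * real n ^ R \<le> real (card (anticliques V s E)) * real n ^ (R - s)" by linarith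
    then have "c * real n ^ s * real n ^ (R - s) \<le> real (card (anticliques V s E)) * real n ^ (R - s)"
      using split_power[of s] by (simp add: R_def mult.assoc)
    then show "c * real n ^ s \<le> real (card (anticliques V s E))"
      using \<open>R < n\<close> by (simp add: mult_le_cancel_right)
  qed
  with \<open>0 < c\<close> show ?thesis by blast
qed

lemma clique_free_containers_many_anticliques:
  assumes "2 \<le> r" and "a = 1 / max_2_density (complete_graph r)"
  shows "\<exists>c>0. \<exists>m. \<exists>K>0. \<forall>\<^sub>F n in sequentially. \<forall>V::'a set. card V = n \<longrightarrow>
    has_containers (K * real n powr (2 - a)) m (clique_free V r)
      {C. c * real n ^ s \<le> real (card (anticliques V s C))}"
proof -
  obtain c where "0 < c" and many: "\<forall>\<^sub>F n in sequentially. \<forall>(V::'a set) E. card V = n \<longrightarrow>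
      real (card (cliques V r E)) \<le> c * real n ^ r \<longrightarrow> c * real n ^ s \<le> real (card (anticliques V s E))"
    using few_cliques_imp_many_anticliques by blast
  obtain m K where "0 < K" and few: "\<forall>\<^sub>F n in sequentially. \<forall>V::'a set. card V = n \<longrightarrow>
      has_containers (K * real n powr (2 - a)) m (clique_free V r)
        {C. real (card (cliques V r C)) \<le> c * real n ^ r}"
    using clique_free_containers[OF assms(1) \<open>0 < c\<close> assms(2)] by blast
  from few many have "\<forall>\<^sub>F n in sequentially. \<forall>V::'a set. card V = n \<longrightarrow>
      has_containers (K * real n powr (2 - a)) m (clique_free V r)
        {C. c * real n ^ s \<le> real (card (anticliques V s C))}"
  proof eventually_elim
    case (elim n)
    then have "{C. real (card (cliques V r C)) \<le> c * real n ^ r}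
        \<subseteq> {C. c * real n ^ s \<le> real (card (anticliques V s C))}" if "card V = n" for V :: "'a set"
      using that by blast
    with elim(1) show ?case using has_containers_mono by blast
  qed
  with \<open>0 < c\<close> \<open>0 < K\<close> show ?thesis by blast
qed

section \<open>Ramsey properties of primal graphs\<close>

lemma hypergraph_iso_complete_graph:
  assumes "W \<in> [V]\<^bsup>r\<^esup>"
  shows "hypergraph_iso (complete_graph r) (W, [W]\<^bsup>2\<^esup>)"
proof -
  have "finite W" "card W = r" using assms by (auto simp: nsets_def)
  then obtain f where bij_f: "bij_betw f {..<r} W"
    using finite_same_card_bij[of "{..<r}" W] by auto
  moreover have "[W]\<^bsup>2\<^esup> = (\<lambda>e. f ` e) ` [{..<r}]\<^bsup>2\<^esup>"
    using bij_betw_nsets[OF bij_f] by (simp add: bij_betw_def)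
  ultimately show ?thesis by (auto simp: hypergraph_iso_def complete_graph_eq_nsets)
qed

lemma edges_primal_graph: "edges (primal_graph H) = (\<Union>h\<in>edges H. [h]\<^bsup>2\<^esup>)"
  by (auto simp: primal_graph_def elim!: nsets2_E)

lemma monochromatic_copy_complete_graph:
  assumes "W \<in> [verts H]\<^bsup>r\<^esup>" and "[W]\<^bsup>2\<^esup> \<subseteq> edges (primal_graph H)" and "\<And>e. e \<in> [W]\<^bsup>2\<^esup> \<Longrightarrow> col e = c"
  shows "monochromatic_copy (primal_graph H) col c (complete_graph r)"
proof -
  have "subhypergraph (W, [W]\<^bsup>2\<^esup>) (primal_graph H)"
    using assms(1,2) by (auto simp: subhypergraph_def primal_graph_def nsets_def)
  with hypergraph_iso_complete_graph[OF assms(1)] assms(3) show ?thesis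
    unfolding monochromatic_copy_def by (intro exI[of _ "(W, [W]\<^bsup>2\<^esup>)"]) auto
qed

lemma not_ramsey_arrow_blue_graph:
  assumes "2 \<le> r" and uniform: "edges H \<subseteq> [verts H]\<^bsup>s\<^esup>" and "verts H \<subseteq> V"
    and not_arrow: "\<not> ramsey_arrow (primal_graph H) (complete_graph s) (complete_graph r)"
  obtains B where "B \<subseteq> edges (primal_graph H)" and "B \<in> clique_free V r"
    and "\<And>h. h \<in> edges H \<Longrightarrow> \<not> indep h B"
proof -
  obtain col where no_red: "\<not> monochromatic_copy (primal_graph H) col Red (complete_graph s)"
    and no_blue: "\<not> monochromatic_copy (primal_graph H) col Blue (complete_graph r)"
    using not_arrow unfolding ramsey_arrow_def by blast
  define B where "B = {e \<in> edges (primal_graph H). col e = Blue}"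
  have B_verts: "B \<subseteq> [verts H]\<^bsup>2\<^esup>"
    using uniform by (fastforce simp: B_def edges_primal_graph nsets_def)
  have "\<not> indep h B" if h_edge: "h \<in> edges H" for h
  proof
    assume "indep h B"
    moreover have edges: "[h]\<^bsup>2\<^esup> \<subseteq> edges (primal_graph H)" using h_edge by (auto simp: edges_primal_graph)
    ultimately have "col e = Red" if "e \<in> [h]\<^bsup>2\<^esup>" for e
      using that by (cases "col e") (auto simp: indep_iff_nsets B_def)
    with no_red monochromatic_copy_complete_graph[of h H s col Red] h_edge uniform edges show False by blast
  qed
  moreover have "W \<notin> cliques V r B" for W
  proof
    assume "W \<in> cliques V r B"
    then have W: "[W]\<^bsup>2\<^esup> \<subseteq> B" "finite W" "card W = r"
      unfolding cliques_def clique_iff_nsets nsets_def[of _ r] by auto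
    have "W = \<Union>([W]\<^bsup>2\<^esup>)" using Union_nsets_2[of W] W(3) \<open>2 \<le> r\<close> by simp
    also have "\<dots> \<subseteq> \<Union>([verts H]\<^bsup>2\<^esup>)" using W(1) B_verts by blast
    also have "\<dots> \<subseteq> verts H" by (auto simp: nsets_def)
    finally have "W \<in> [verts H]\<^bsup>r\<^esup>" using W(2,3) by (simp add: nsets_def)
    moreover have "[W]\<^bsup>2\<^esup> \<subseteq> edges (primal_graph H)" "\<And>e. e \<in> [W]\<^bsup>2\<^esup> \<Longrightarrow> col e = Blue"
      using W(1) by (auto simp: B_def)
    ultimately show False using no_blue monochromatic_copy_complete_graph by blast
  qed
  ultimately show thesis
    using B_verts nsets_mono[OF \<open>verts H \<subseteq> V\<close>, of 2]
    by (intro that[of B]) (auto simp: B_def clique_free_def)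
qed

lemma ex_subcover_card_le:
  assumes "finite T" and "T \<subseteq> \<Union>(f ` A)"
  obtains \<F> where "\<F> \<subseteq> A" and "card \<F> \<le> card T" and "T \<subseteq> \<Union>(f ` \<F>)"
proof -
  have "\<forall>x\<in>T. \<exists>a. a \<in> A \<and> x \<in> f a" using assms(2) by auto
  then obtain \<phi> where "\<forall>x\<in>T. \<phi> x \<in> A \<and> x \<in> f (\<phi> x)" by (rule bchoice[THEN exE])
  then show thesis by (intro that[of "\<phi> ` T"]) (auto intro: card_image_le assms(1))
qed

text \<open>If the hyperedges in \<open>\<F>\<close> cover the fingerprints \<open>L\<close> of the blue graph, then the \<open>s\<close>-sets without an
  edge of the container \<open>f L\<close> contain no blue edge and hence are not hyperedges.\<close>

definition forced_nonedges ::
  "'a set \<Rightarrow> nat \<Rightarrow> real \<Rightarrow> nat \<Rightarrow> ('a set set list \<Rightarrow> 'a set set) \<Rightarrow> 'a set set \<Rightarrow> 'a set set set" where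
  "forced_nonedges V s d m f \<F> =
    {S \<in> (\<lambda>L. anticliques V s (f L)) ` {L. set L \<subseteq> Pow (\<Union>h\<in>\<F>. [h]\<^bsup>2\<^esup>) \<and> length L = m}.
      d \<le> real (card S) \<and> \<F> \<inter> S = {}}"

lemma card_forced_nonedges_le:
  assumes "finite \<F>" and "\<F> \<subseteq> [V]\<^bsup>s\<^esup>"
  shows "finite (forced_nonedges V s d m f \<F>)"
    and "real (card (forced_nonedges V s d m f \<F>)) \<le> (2 ^ (s ^ 2 * m)) ^ card \<F>"
proof -
  let ?U = "\<Union>h\<in>\<F>. [h]\<^bsup>2\<^esup>"
  let ?Ls = "{L. set L \<subseteq> Pow ?U \<and> length L = m}"
  have "finite ?U" using assms by (auto simp: nsets_def intro: finite_imp_finite_nsets)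
  have "card ?U \<le> (\<Sum>h\<in>\<F>. card ([h]\<^bsup>2\<^esup>))" using assms(1) by (rule card_UN_le)
  also have "\<dots> \<le> (\<Sum>h\<in>\<F>. s ^ 2)"
  proof (rule sum_mono)
    fix h assume "h \<in> \<F>"
    then have "card h = s" using assms(2) by (auto simp: nsets_def)
    then show "card ([h]\<^bsup>2\<^esup>) \<le> s ^ 2" by (simp add: binomial_le_power)
  qed
  finally have card_U: "card ?U \<le> s ^ 2 * card \<F>" by (simp add: mult.commute)
  have finite_Ls: "finite ?Ls" using \<open>finite ?U\<close> by (intro finite_lists_length_eq) simp
  have subset: "forced_nonedges V s d m f \<F> \<subseteq> (\<lambda>L. anticliques V s (f L)) ` ?Ls"
    by (auto simp: forced_nonedges_def)
  then show "finite (forced_nonedges V s d m f \<F>)" using finite_Ls by (rule finite_surj[rotated])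
  have "card (forced_nonedges V s d m f \<F>) \<le> card ?Ls" using finite_Ls subset by (rule surj_card_le)
  also have "\<dots> = 2 ^ (card ?U * m)"
    using \<open>finite ?U\<close> by (simp add: card_lists_length_eq card_Pow power_mult)
  also have "\<dots> \<le> 2 ^ (s ^ 2 * card \<F> * m)" using card_U by (intro power_increasing mult_right_mono) auto
  also have "\<dots> = (2 ^ (s ^ 2 * m)) ^ card \<F>" by (simp add: mult_ac flip: power_mult)
  finally show "real (card (forced_nonedges V s d m f \<F>)) \<le> (2 ^ (s ^ 2 * m)) ^ card \<F>"
    by (simp flip: of_nat_le_iff[where ?'a = real])
qed

lemma not_ramsey_arrow_certificate:
  assumes "2 \<le> r" and "finite V" and "0 \<le> t"
    and containers: "container_function t m (clique_free V r) {C. d \<le> real (card (anticliques V s C))} f"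
    and H_edges: "edges H \<subseteq> [verts H]\<^bsup>s\<^esup>" "verts H \<subseteq> V"
    and not_arrow: "\<not> ramsey_arrow (primal_graph H) (complete_graph s) (complete_graph r)"
  obtains \<F> S where "\<F> \<subseteq> edges H" and "real (card \<F>) \<le> real m * t"
    and "S \<in> forced_nonedges V s d m f \<F>" and "edges H \<inter> S = {}"
proof -
  obtain B where B: "B \<subseteq> edges (primal_graph H)" "B \<in> clique_free V r"
    and blue: "\<And>h. h \<in> edges H \<Longrightarrow> \<not> indep h B"
    by (rule not_ramsey_arrow_blue_graph[OF \<open>2 \<le> r\<close> H_edges not_arrow]) blast
  from containers B(2) obtain L where L: "L \<in> fingerprints t m B" "B \<subseteq> f L"
    and large: "d \<le> real (card (anticliques V s (f L)))"
    unfolding container_function_def by blast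
  define T where "T = \<Union>(set L)"
  have "T \<subseteq> B" "length L = m" using L(1) by (auto simp: T_def fingerprints_def)
  then have "finite T"
    using B(2) \<open>finite V\<close>
    by (auto simp: clique_free_def dest!: finite_subset intro: finite_imp_finite_nsets)
  moreover have "T \<subseteq> (\<Union>h\<in>edges H. [h]\<^bsup>2\<^esup>)" using \<open>T \<subseteq> B\<close> B(1) by (simp add: edges_primal_graph)
  ultimately obtain \<F> where \<F>: "\<F> \<subseteq> edges H" "card \<F> \<le> card T" "T \<subseteq> (\<Union>h\<in>\<F>. [h]\<^bsup>2\<^esup>)"
    by (rule ex_subcover_card_le)
  have "\<not> indep h (f L)" if "h \<in> edges H" for h
    using blue[OF that] L(2) by (auto simp: indep_def)
  then have disjoint: "edges H \<inter> anticliques V s (f L) = {}" by (auto simp: anticliques_def)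
  show thesis
  proof (rule that[of \<F> "anticliques V s (f L)"])
    show "real (card \<F>) \<le> real m * t"
      using \<F>(2) card_Union_fingerprints_le[OF L(1) \<open>0 \<le> t\<close>] by (simp add: T_def)
    show "anticliques V s (f L) \<in> forced_nonedges V s d m f \<F>"
      unfolding forced_nonedges_def
      using large \<F>(1,3) disjoint \<open>length L = m\<close> by (auto simp: T_def intro!: imageI)
  qed (use \<F> disjoint in auto)
qed

definition has_sparse_certificate :: "('a set \<Rightarrow> 'a set set) \<Rightarrow> real \<Rightarrow> real \<Rightarrow> 'a set \<Rightarrow> bool" where
  "has_sparse_certificate \<S> u \<epsilon> A \<longleftrightarrow>
    (\<exists>\<F>\<subseteq>A. real (card \<F>) \<le> u \<and> (\<exists>S\<in>\<S> \<F>. real (card (A \<inter> S)) \<le> \<epsilon> * real (card A)))"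

definition resilient_ramsey :: "real \<Rightarrow> nat \<Rightarrow> nat \<Rightarrow> 'a hypergraph \<Rightarrow> bool" where
  "resilient_ramsey \<epsilon> s r H \<longleftrightarrow>
    (\<forall>H0. subhypergraph H0 H \<and> real (card (edges H0)) \<ge> (1 - \<epsilon>) * real (card (edges H)) \<longrightarrow>
      ramsey_arrow (primal_graph H0) (complete_graph s) (complete_graph r))"

lemma resilient_ramsey_antimono:
  assumes "resilient_ramsey \<delta> s r H" and "\<epsilon> \<le> \<delta>"
  shows "resilient_ramsey \<epsilon> s r H"
proof -
  have "(1 - \<delta>) * real (card (edges H)) \<le> (1 - \<epsilon>) * real (card (edges H))"
    using assms(2) by (intro mult_right_mono) auto
  with assms(1) show ?thesis unfolding resilient_ramsey_def by (meson order_trans)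
qed

lemma not_resilient_ramsey_certificate:
  assumes "2 \<le> r" and "finite V" and "0 \<le> t"
    and containers: "container_function t m (clique_free V r) {C. d \<le> real (card (anticliques V s C))} f"
    and uniform: "A \<subseteq> [V]\<^bsup>s\<^esup>" and "\<not> resilient_ramsey \<epsilon> s r (V, A)"
  shows "has_sparse_certificate (forced_nonedges V s d m f) (real m * t) \<epsilon> A"
proof -
  obtain H0 where sub: "subhypergraph H0 (V, A)"
    and large: "(1 - \<epsilon>) * real (card A) \<le> real (card (edges H0))"
    and not_arrow: "\<not> ramsey_arrow (primal_graph H0) (complete_graph s) (complete_graph r)"
    using assms(6) by (auto simp: resilient_ramsey_def)
  have H0: "verts H0 \<subseteq> V" "edges H0 \<subseteq> A" "edges H0 \<subseteq> [verts H0]\<^bsup>s\<^esup>"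
    using sub uniform by (auto simp: subhypergraph_def nsets_def)
  obtain \<F> S where \<F>: "\<F> \<subseteq> edges H0" "real (card \<F>) \<le> real m * t"
    and S: "S \<in> forced_nonedges V s d m f \<F>" and disjoint: "edges H0 \<inter> S = {}"
    using not_ramsey_arrow_certificate[OF assms(1-4) H0(3,1) not_arrow] .
  have "finite A" using assms(2) uniform by (rule finite_uniform)
  have "card (edges H0) + card (A \<inter> S) = card (edges H0 \<union> A \<inter> S)"
    using H0(2) disjoint \<open>finite A\<close> by (intro card_Un_disjoint[symmetric]) (auto intro: finite_subset)
  also have "\<dots> \<le> card A" using H0(2) \<open>finite A\<close> by (intro card_mono) auto
  finally have "real (card (edges H0)) + real (card (A \<inter> S)) \<le> real (card A)" by (simp flip: of_nat_add)
  then have "real (card (A \<inter> S)) \<le> \<epsilon> * real (card A)" using large by (simp add: algebra_simps)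
  with \<F> S H0(2) show ?thesis unfolding has_sparse_certificate_def by blast
qed

section \<open>Random subsets\<close>

definition random_subset :: "'a set \<Rightarrow> real \<Rightarrow> 'a set pmf" where
  "random_subset E p = map_pmf (\<lambda>X. {e \<in> E. X e}) (Pi_pmf E False (\<lambda>_. bernoulli_pmf p))"

lemma set_pmf_random_subset: "set_pmf (random_subset E p) \<subseteq> Pow E"
  by (auto simp: random_subset_def)

lemma integrable_random_subset:
  fixes f :: "'a set \<Rightarrow> real"
  assumes "finite E"
  shows "integrable (measure_pmf (random_subset E p)) f"
  using assms finite_subset[OF set_pmf_random_subset] by (intro integrable_measure_pmf_finite) simp

lemma random_hypergraph_eq_random_subset:
  "random_hypergraph s n p = map_pmf (\<lambda>A. ({..<n}, A)) (random_subset ([{..<n}]\<^bsup>s\<^esup>) p)"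
proof -
  have "edges (complete_hypergraph s n) = [{..<n}]\<^bsup>s\<^esup>"
    by (auto simp: complete_hypergraph_def nsets_def finite_subset)
  then show ?thesis by (simp add: random_hypergraph_def random_subset_def map_pmf_comp)
qed

lemma expectation_prod_random_subset:
  fixes f g :: "'a \<Rightarrow> real"
  assumes "finite E" and "0 \<le> p" "p \<le> 1" and "\<And>e. 0 \<le> f e" "\<And>e. 0 \<le> g e"
  shows "measure_pmf.expectation (random_subset E p) (\<lambda>A. \<Prod>e\<in>E. if e \<in> A then f e else g e)
    = (\<Prod>e\<in>E. p * f e + (1 - p) * g e)"
proof -
  let ?choose = "\<lambda>e b. if b then f e else g e"
  have "(\<Prod>e\<in>E. ?choose e (e \<in> {e \<in> E. X e})) = (\<Prod>e\<in>E. ?choose e (X e))" for X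
    by (intro prod.cong) auto
  then have "measure_pmf.expectation (random_subset E p) (\<lambda>A. \<Prod>e\<in>E. ?choose e (e \<in> A))
      = measure_pmf.expectation (Pi_pmf E False (\<lambda>_. bernoulli_pmf p)) (\<lambda>X. \<Prod>e\<in>E. ?choose e (X e))"
    unfolding random_subset_def integral_map_pmf by simp
  also have "\<dots> = (\<Prod>e\<in>E. measure_pmf.expectation (bernoulli_pmf p) (?choose e))"
    using assms by (intro expectation_prod_Pi_pmf integrable_measure_pmf_finite finite) auto
  also have "\<dots> = (\<Prod>e\<in>E. p * f e + (1 - p) * g e)" using assms(2,3) by (simp add: mult.commute)
  finally show ?thesis .
qed

lemma expectation_random_subset_weight:
  fixes p y z :: real
  assumes "finite E" and subsets: "\<F> \<subseteq> E" "S \<subseteq> E" "\<F> \<inter> S = {}"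
    and p_bounds: "0 \<le> p" "p \<le> 1" and "0 \<le> y" "0 \<le> z"
  shows "measure_pmf.expectation (random_subset E p)
      (\<lambda>A. of_bool (\<F> \<subseteq> A) * y ^ card A * z ^ card (A \<inter> S))
    = (p * y) ^ card \<F> * (1 + p * (y * z - 1)) ^ card S * (1 + p * (y - 1)) ^ card (E - \<F> - S)"
proof -
  let ?present = "\<lambda>e. y * (if e \<in> S then z else 1)" and ?absent = "\<lambda>e. of_bool (e \<notin> \<F>) :: real"
  have weight: "of_bool (\<F> \<subseteq> A) * y ^ card A * z ^ card (A \<inter> S)
      = (\<Prod>e\<in>E. if e \<in> A then ?present e else ?absent e)"
    if "A \<subseteq> E" for A
  proof -
    have "(\<Prod>e\<in>E. if e \<in> A then ?present e else ?absent e) = (\<Prod>e\<in>A. ?present e) * (\<Prod>e\<in>E - A. ?absent e)"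
      using \<open>finite E\<close> that by (simp add: prod.If_cases Int_absorb1 Diff_eq)
    also have "(\<Prod>e\<in>A. ?present e) = y ^ card A * z ^ card (A \<inter> S)"
      using \<open>finite E\<close> that by (simp add: prod.distrib prod.If_cases finite_subset)
    also have "(\<Prod>e\<in>E - A. ?absent e) = of_bool (\<F> \<subseteq> A)"
      using \<open>finite E\<close> subsets(1) by (cases "\<F> \<subseteq> A") (auto simp: prod_zero_iff intro!: prod.neutral)
    finally show ?thesis by simp
  qed
  have "AE A in random_subset E p. of_bool (\<F> \<subseteq> A) * y ^ card A * z ^ card (A \<inter> S)
      = (\<Prod>e\<in>E. if e \<in> A then ?present e else ?absent e)"
    by (intro AE_pmfI weight) (use set_pmf_random_subset in blast)
  then have "measure_pmf.expectation (random_subset E p)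
        (\<lambda>A. of_bool (\<F> \<subseteq> A) * y ^ card A * z ^ card (A \<inter> S))
      = measure_pmf.expectation (random_subset E p) (\<lambda>A. \<Prod>e\<in>E. if e \<in> A then ?present e else ?absent e)"
    by (rule integral_cong_AE[rotated 2]) simp_all
  also have "\<dots> = (\<Prod>e\<in>E. p * ?present e + (1 - p) * ?absent e)"
    using assms by (intro expectation_prod_random_subset) auto
  also have "\<dots> = (\<Prod>e\<in>E. (if e \<in> \<F> then p * y else 1) * (if e \<in> S then 1 + p * (y * z - 1) else 1) *
      (if e \<in> E - \<F> - S then 1 + p * (y - 1) else 1))"
    using subsets(3) by (intro prod.cong) (auto simp: algebra_simps)
  also have "\<dots> = (p * y) ^ card \<F> * (1 + p * (y * z - 1)) ^ card S * (1 + p * (y - 1)) ^ card (E - \<F> - S)"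
  proof -
    have "E \<inter> {e. e \<in> \<F>} = \<F>" "E \<inter> {e. e \<in> S} = S" "E \<inter> {e. e \<in> E - \<F> - S} = E - \<F> - S"
      using subsets by auto
    then show ?thesis
      using \<open>finite E\<close> by (simp only: prod.distrib prod.If_cases) (simp add: power_mult_distrib)
  qed
  finally show ?thesis .
qed

lemma one_plus_power_le_exp: "- 1 \<le> x \<Longrightarrow> (1 + x) ^ n \<le> exp (x * real n)"
  unfolding exp_of_nat2_mult by (intro power_mono exp_ge_add_one_self) simp

text \<open>Markov's inequality for \<open>2 powr (\<epsilon> * card A - card (A \<inter> S))\<close> restricted to \<open>\<F> \<subseteq> A\<close>; this variable
  is a product over the elements of \<open>E\<close>, so no separate concentration bound for \<open>card A\<close> is needed.\<close>

lemma prob_random_subset_le_weight: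
  fixes p \<epsilon> :: real
  assumes "finite E"
  shows "measure_pmf.prob (random_subset E p) {A. \<F> \<subseteq> A \<and> real (card (A \<inter> S)) \<le> \<epsilon> * real (card A)}
    \<le> measure_pmf.expectation (random_subset E p)
        (\<lambda>A. of_bool (\<F> \<subseteq> A) * (2 powr \<epsilon>) ^ card A * (1 / 2) ^ card (A \<inter> S))"
proof -
  let ?bad = "{A. \<F> \<subseteq> A \<and> real (card (A \<inter> S)) \<le> \<epsilon> * real (card A)}"
  let ?weight = "\<lambda>A. of_bool (\<F> \<subseteq> A) * (2 powr \<epsilon>) ^ card A * (1 / 2) ^ card (A \<inter> S) :: real"
  have "indicator ?bad A \<le> ?weight A" for A
  proof (cases "A \<in> ?bad")
    case True
    have "(2 powr \<epsilon>) ^ card A * (1 / 2) ^ card (A \<inter> S) = 2 powr (\<epsilon> * real (card A) - real (card (A \<inter> S)))"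
      by (simp add: powr_diff powr_realpow powr_power power_one_over inverse_eq_divide mult.commute)
    with True show ?thesis
      using ge_one_powr_ge_zero[of 2 "\<epsilon> * real (card A) - real (card (A \<inter> S))"] by simp
  qed simp
  then show ?thesis
    using \<open>finite E\<close> integral_mono[OF integrable_random_subset integrable_random_subset,
        of E p "indicator ?bad" ?weight]
    by simp
qed

lemma prob_random_subset_le:
  fixes p \<epsilon> :: real
  assumes "finite E" and subsets: "\<F> \<subseteq> E" "S \<subseteq> E" "\<F> \<inter> S = {}"
    and p_bounds: "0 \<le> p" "p \<le> 1" and "0 \<le> \<epsilon>" "\<epsilon> \<le> 1"
  shows "measure_pmf.prob (random_subset E p) {A. \<F> \<subseteq> A \<and> real (card (A \<inter> S)) \<le> \<epsilon> * real (card A)}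
    \<le> (2 * p) ^ card \<F> * exp (- p * (1 - 2 powr \<epsilon> / 2) * real (card S)) *
      exp (p * (2 powr \<epsilon> - 1) * real (card E))" (is "?prob \<le> _")
proof -
  define y where "y = 2 powr \<epsilon>"
  have y_bounds: "1 \<le> y" "y \<le> 2"
    using \<open>0 \<le> \<epsilon>\<close> \<open>\<epsilon> \<le> 1\<close> powr_mono[of \<epsilon> 1 "2::real"] by (auto simp: y_def ge_one_powr_ge_zero)
  have "?prob \<le> (p * y) ^ card \<F> * (1 + p * (y * (1 / 2) - 1)) ^ card S *
      (1 + p * (y - 1)) ^ card (E - \<F> - S)"
    using prob_random_subset_le_weight[OF \<open>finite E\<close>, of p \<F> S \<epsilon>] y_bounds
      expectation_random_subset_weight[OF \<open>finite E\<close> subsets p_bounds, of y "1 / 2"]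
    by (simp add: y_def)
  also have "\<dots> \<le> (2 * p) ^ card \<F> * exp (- p * (1 - y / 2) * real (card S)) *
      exp (p * (y - 1) * real (card E))"
  proof (intro mult_mono)
    show "(p * y) ^ card \<F> \<le> (2 * p) ^ card \<F>"
      using p_bounds y_bounds mult_left_mono[of y 2 p] by (intro power_mono) (auto simp: mult.commute)
    have lower: "- 1 \<le> p * (y * (1 / 2) - 1)"
      using p_bounds y_bounds mult_mono[of p 1 "1 - y * (1 / 2)" 1] by (simp add: algebra_simps)
    then show "0 \<le> (1 + p * (y * (1 / 2) - 1)) ^ card S" by simp
    show "(1 + p * (y * (1 / 2) - 1)) ^ card S \<le> exp (- p * (1 - y / 2) * real (card S))"
      using one_plus_power_le_exp[OF lower, of "card S"] by (simp add: algebra_simps)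
    have "(1 + p * (y - 1)) ^ card (E - \<F> - S) \<le> (1 + p * (y - 1)) ^ card E"
      using p_bounds y_bounds \<open>finite E\<close> by (intro power_increasing card_mono) auto
    also have "\<dots> \<le> exp (p * (y - 1) * real (card E))"
      by (rule one_plus_power_le_exp, rule order_trans[of _ 0]) (use p_bounds y_bounds in auto)
    finally show "(1 + p * (y - 1)) ^ card (E - \<F> - S) \<le> exp (p * (y - 1) * real (card E))" .
  qed (use p_bounds y_bounds in auto)
  finally show ?thesis unfolding y_def .
qed

lemma prob_random_subset_few_le:
  fixes p M c \<epsilon> :: real
  assumes "finite E" and card_E: "real (card E) \<le> M" and p_bounds: "0 \<le> p" "p \<le> 1" and "0 < c"
    and \<epsilon>_bounds: "0 \<le> \<epsilon>" "2 powr \<epsilon> \<le> 3 / 2" "2 powr \<epsilon> \<le> 1 + c / 8"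
    and subsets: "\<F> \<subseteq> E" "S \<subseteq> E" "\<F> \<inter> S = {}" and card_S: "c * M \<le> real (card S)"
  shows "measure_pmf.prob (random_subset E p) {A. \<F> \<subseteq> A \<and> real (card (A \<inter> S)) \<le> \<epsilon> * real (card A)}
    \<le> (2 * p) ^ card \<F> * exp (- (c / 8) * (p * M))"
proof -
  have "0 \<le> M" using card_E by linarith
  have "\<epsilon> \<le> 1" using \<epsilon>_bounds(2) powr_le_cancel_iff[of 2 \<epsilon> 1] by simp
  have "p * (c * M) * (1 / 4) \<le> p * real (card S) * (1 - 2 powr \<epsilon> / 2)"
    using p_bounds \<epsilon>_bounds card_S \<open>0 < c\<close> \<open>0 \<le> M\<close> by (intro mult_mono mult_left_mono) auto
  moreover have "p * real (card E) * (2 powr \<epsilon> - 1) \<le> p * M * (c / 8)"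
    using p_bounds \<epsilon>_bounds card_E ge_one_powr_ge_zero[of 2 \<epsilon>] \<open>0 \<le> M\<close>
    by (intro mult_mono mult_left_mono) auto
  ultimately have "- p * (1 - 2 powr \<epsilon> / 2) * real (card S) + p * (2 powr \<epsilon> - 1) * real (card E)
      \<le> - (c / 8) * (p * M)"
    by (simp add: algebra_simps)
  then have "exp (- p * (1 - 2 powr \<epsilon> / 2) * real (card S)) * exp (p * (2 powr \<epsilon> - 1) * real (card E))
      \<le> exp (- (c / 8) * (p * M))"
    by (simp flip: exp_add)
  then have "(2 * p) ^ card \<F> * (exp (- p * (1 - 2 powr \<epsilon> / 2) * real (card S)) *
      exp (p * (2 powr \<epsilon> - 1) * real (card E))) \<le> (2 * p) ^ card \<F> * exp (- (c / 8) * (p * M))"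
    using p_bounds by (intro mult_left_mono) auto
  with prob_random_subset_le[OF \<open>finite E\<close> subsets p_bounds \<epsilon>_bounds(1) \<open>\<epsilon> \<le> 1\<close>] show ?thesis
    unfolding mult.assoc by (rule order_trans)
qed

lemma sum_power_card_Pow:
  fixes x :: "'b::comm_semiring_1"
  assumes "finite E"
  shows "(\<Sum>\<F>\<in>Pow E. x ^ card \<F>) = (1 + x) ^ card E"
  using prod_add[OF assms, of "\<lambda>_. x" "\<lambda>_. 1"] by (simp add: add.commute)

text \<open>Paying \<open>\<Lambda> powr u\<close> for the bound \<open>card \<F> \<le> u\<close> reduces the weight of each element from \<open>x\<close> to \<open>x / \<Lambda>\<close>.\<close>

lemma sum_power_bounded_card_le:
  fixes x u \<Lambda> :: real
  assumes "finite E" and "0 \<le> x" and "1 \<le> \<Lambda>"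
  shows "(\<Sum>\<F> | \<F> \<subseteq> E \<and> real (card \<F>) \<le> u. x ^ card \<F>) \<le> \<Lambda> powr u * exp (x / \<Lambda> * real (card E))"
proof -
  have "(\<Sum>\<F> | \<F> \<subseteq> E \<and> real (card \<F>) \<le> u. x ^ card \<F>)
      \<le> (\<Sum>\<F> | \<F> \<subseteq> E \<and> real (card \<F>) \<le> u. \<Lambda> powr u * (x / \<Lambda>) ^ card \<F>)"
  proof (rule sum_mono)
    fix \<F> assume "\<F> \<in> {\<F>. \<F> \<subseteq> E \<and> real (card \<F>) \<le> u}"
    then have "\<Lambda> powr real (card \<F>) \<le> \<Lambda> powr u" using \<open>1 \<le> \<Lambda>\<close> by (intro powr_mono) auto
    moreover have "x ^ card \<F> = \<Lambda> powr real (card \<F>) * (x / \<Lambda>) ^ card \<F>"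
      using \<open>1 \<le> \<Lambda>\<close> by (simp add: powr_realpow power_divide)
    ultimately show "x ^ card \<F> \<le> \<Lambda> powr u * (x / \<Lambda>) ^ card \<F>"
      using assms by (simp only:) (intro mult_right_mono, auto)
  qed
  also have "\<dots> \<le> (\<Sum>\<F>\<in>Pow E. \<Lambda> powr u * (x / \<Lambda>) ^ card \<F>)"
    by (rule sum_mono2) (use assms in auto)
  also have "\<dots> = \<Lambda> powr u * (1 + x / \<Lambda>) ^ card E"
    using sum_power_card_Pow[OF \<open>finite E\<close>, of "x / \<Lambda>"] by (simp flip: sum_distrib_left)
  also have "\<dots> \<le> \<Lambda> powr u * exp (x / \<Lambda> * real (card E))"
    by (rule mult_left_mono, rule one_plus_power_le_exp, rule order_trans[of _ 0]) (use assms in auto)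
  finally show ?thesis .
qed

lemma prob_has_sparse_certificate_le_sum:
  assumes "finite E" and "\<And>\<F>. \<F> \<subseteq> E \<Longrightarrow> finite (\<S> \<F>)"
  shows "measure_pmf.prob (random_subset E p) {A. has_sparse_certificate \<S> u \<epsilon> A}
    \<le> (\<Sum>\<F> | \<F> \<subseteq> E \<and> real (card \<F>) \<le> u. \<Sum>S\<in>\<S> \<F>.
        measure_pmf.prob (random_subset E p) {A. \<F> \<subseteq> A \<and> real (card (A \<inter> S)) \<le> \<epsilon> * real (card A)})"
    (is "measure_pmf.prob ?P ?bad \<le> _")
proof -
  let ?\<FF> = "{\<F>. \<F> \<subseteq> E \<and> real (card \<F>) \<le> u}"
  let ?few = "\<lambda>\<F> S. {A. \<F> \<subseteq> A \<and> real (card (A \<inter> S)) \<le> \<epsilon> * real (card A)}"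
  have "?bad \<inter> set_pmf ?P \<subseteq> (\<Union>\<F>\<in>?\<FF>. \<Union>S\<in>\<S> \<F>. ?few \<F> S)"
  proof
    fix A assume A_bad: "A \<in> ?bad \<inter> set_pmf ?P"
    then obtain \<F> S where "\<F> \<subseteq> A" "real (card \<F>) \<le> u" "S \<in> \<S> \<F>"
      "real (card (A \<inter> S)) \<le> \<epsilon> * real (card A)" unfolding has_sparse_certificate_def by blast
    moreover have "A \<subseteq> E" using A_bad set_pmf_random_subset by blast
    ultimately show "A \<in> (\<Union>\<F>\<in>?\<FF>. \<Union>S\<in>\<S> \<F>. ?few \<F> S)"
      by (intro UN_I[of \<F>] UN_I[of S]) auto
  qed
  then have "measure_pmf.prob ?P ?bad \<le> measure_pmf.prob ?P (\<Union>\<F>\<in>?\<FF>. \<Union>S\<in>\<S> \<F>. ?few \<F> S)"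
    unfolding measure_Int_set_pmf[of ?P ?bad, symmetric] by (rule measure_pmf.finite_measure_mono) simp
  also have "\<dots> \<le> (\<Sum>\<F>\<in>?\<FF>. measure_pmf.prob ?P (\<Union>S\<in>\<S> \<F>. ?few \<F> S))"
    using assms(1) by (intro measure_UNION_le) auto
  also have "\<dots> \<le> (\<Sum>\<F>\<in>?\<FF>. \<Sum>S\<in>\<S> \<F>. measure_pmf.prob ?P (?few \<F> S))"
    using assms(2) by (intro sum_mono measure_UNION_le) auto
  finally show ?thesis .
qed

lemma prob_has_sparse_certificate_le:
  fixes p M c \<epsilon> u q \<Lambda> :: real
  assumes "finite E" and card_E: "real (card E) \<le> M" and p_bounds: "0 \<le> p" "p \<le> 1" and "0 < c"
    and \<epsilon>_bounds: "0 \<le> \<epsilon>" "2 powr \<epsilon> \<le> 3 / 2" "2 powr \<epsilon> \<le> 1 + c / 8" and "0 \<le> q" "1 \<le> \<Lambda>"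
    and family: "\<And>\<F> S. \<F> \<subseteq> E \<Longrightarrow> S \<in> \<S> \<F> \<Longrightarrow> S \<subseteq> E \<and> \<F> \<inter> S = {} \<and> c * M \<le> real (card S)"
    and card_family: "\<And>\<F>. \<F> \<subseteq> E \<Longrightarrow> finite (\<S> \<F>) \<and> real (card (\<S> \<F>)) \<le> q ^ card \<F>"
  shows "measure_pmf.prob (random_subset E p) {A. has_sparse_certificate \<S> u \<epsilon> A}
    \<le> \<Lambda> powr u * exp ((2 * q / \<Lambda> - c / 8) * (p * M))" (is "?prob \<le> _")
proof -
  let ?\<FF> = "{\<F>. \<F> \<subseteq> E \<and> real (card \<F>) \<le> u}"
  let ?few = "\<lambda>\<F> S. {A. \<F> \<subseteq> A \<and> real (card (A \<inter> S)) \<le> \<epsilon> * real (card A)}"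
  let ?decay = "exp (- (c / 8) * (p * M))"
  have "?prob \<le> (\<Sum>\<F>\<in>?\<FF>. \<Sum>S\<in>\<S> \<F>. measure_pmf.prob (random_subset E p) (?few \<F> S))"
    using \<open>finite E\<close> card_family by (intro prob_has_sparse_certificate_le_sum) auto
  also have "\<dots> \<le> (\<Sum>\<F>\<in>?\<FF>. ?decay * (2 * p * q) ^ card \<F>)"
  proof (rule sum_mono)
    fix \<F> assume "\<F> \<in> ?\<FF>"
    then have "\<F> \<subseteq> E" by simp
    have "measure_pmf.prob (random_subset E p) (?few \<F> S) \<le> (2 * p) ^ card \<F> * ?decay"
      if "S \<in> \<S> \<F>" for S
      using family[OF \<open>\<F> \<subseteq> E\<close> that] \<open>finite E\<close> card_E p_bounds \<open>0 < c\<close> \<epsilon>_bounds \<open>\<F> \<subseteq> E\<close>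
      by (intro prob_random_subset_few_le) simp_all
    then have "(\<Sum>S\<in>\<S> \<F>. measure_pmf.prob (random_subset E p) (?few \<F> S))
        \<le> real (card (\<S> \<F>)) * ((2 * p) ^ card \<F> * ?decay)"
      by (rule sum_bounded_above)
    also have "\<dots> \<le> q ^ card \<F> * ((2 * p) ^ card \<F> * ?decay)"
      using card_family[OF \<open>\<F> \<subseteq> E\<close>] p_bounds by (intro mult_right_mono) auto
    finally show "(\<Sum>S\<in>\<S> \<F>. measure_pmf.prob (random_subset E p) (?few \<F> S))
        \<le> ?decay * (2 * p * q) ^ card \<F>"
      by (simp add: power_mult_distrib mult_ac)
  qed
  also have "\<dots> = ?decay * (\<Sum>\<F>\<in>?\<FF>. (2 * p * q) ^ card \<F>)" by (simp add: sum_distrib_left)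
  also have "\<dots> \<le> ?decay * (\<Lambda> powr u * exp (2 * p * q / \<Lambda> * real (card E)))"
    using sum_power_bounded_card_le[OF \<open>finite E\<close> _ \<open>1 \<le> \<Lambda>\<close>] p_bounds \<open>0 \<le> q\<close>
    by (intro mult_left_mono) auto
  also have "\<dots> \<le> ?decay * (\<Lambda> powr u * exp (2 * p * q / \<Lambda> * M))"
    using card_E p_bounds \<open>0 \<le> q\<close> \<open>1 \<le> \<Lambda>\<close> by (simp add: mult_left_mono divide_right_mono)
  also have "\<dots> = \<Lambda> powr u * exp ((2 * q / \<Lambda> - c / 8) * (p * M))"
    by (simp add: algebra_simps flip: exp_add)
  finally show ?thesis .
qed

section \<open>The resilience threshold\<close>

lemma prob_not_resilient_ramsey_le_certificate:
  assumes "2 \<le> r" and "0 \<le> t"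
    and containers: "container_function t m (clique_free {..<n} r) {C. d \<le> real (card (anticliques {..<n} s C))} f"
  shows "measure_pmf.prob (random_hypergraph s n p) {H. \<not> resilient_ramsey \<epsilon> s r H}
    \<le> measure_pmf.prob (random_subset ([{..<n}]\<^bsup>s\<^esup>) p)
        {A. has_sparse_certificate (forced_nonedges {..<n} s d m f) (real m * t) \<epsilon> A}"
  unfolding random_hypergraph_eq_random_subset measure_map_pmf
proof (rule measure_pmf.finite_measure_mono_AE, rule AE_pmfI, rule impI)
  fix A assume "A \<in> set_pmf (random_subset ([{..<n}]\<^bsup>s\<^esup>) p)"
  then have "A \<subseteq> [{..<n}]\<^bsup>s\<^esup>" using set_pmf_random_subset by blast
  moreover assume "A \<in> (\<lambda>A. ({..<n}, A)) -` {H. \<not> resilient_ramsey \<epsilon> s r H}"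
  ultimately show "A \<in> {A. has_sparse_certificate (forced_nonedges {..<n} s d m f) (real m * t) \<epsilon> A}"
    using not_resilient_ramsey_certificate[OF assms(1) finite_lessThan assms(2) containers] by simp
qed simp

lemma prob_not_resilient_ramsey_le:
  fixes p c \<epsilon> t \<Lambda> :: real
  assumes "2 \<le> r" and "0 \<le> t"
    and containers: "has_containers t m (clique_free {..<n} r)
      {C. c * real n ^ s \<le> real (card (anticliques {..<n} s C))}"
    and p_bounds: "0 \<le> p" "p \<le> 1" and "0 < c"
    and \<epsilon>_bounds: "0 \<le> \<epsilon>" "2 powr \<epsilon> \<le> 3 / 2" "2 powr \<epsilon> \<le> 1 + c / 8" and "1 \<le> \<Lambda>"
  shows "measure_pmf.prob (random_hypergraph s n p) {H. \<not> resilient_ramsey \<epsilon> s r H}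
    \<le> \<Lambda> powr (real m * t) * exp ((2 * 2 ^ (s ^ 2 * m) / \<Lambda> - c / 8) * (p * real n ^ s))"
proof -
  let ?E = "[{..<n}]\<^bsup>s\<^esup>"
  from containers obtain f where "container_function t m (clique_free {..<n} r)
      {C. c * real n ^ s \<le> real (card (anticliques {..<n} s C))} f"
    unfolding has_containers_def ..
  note prob_not_resilient_ramsey_le_certificate[OF \<open>2 \<le> r\<close> \<open>0 \<le> t\<close> this, of p \<epsilon>]
  also have "measure_pmf.prob (random_subset ?E p)
        {A. has_sparse_certificate (forced_nonedges {..<n} s (c * real n ^ s) m f) (real m * t) \<epsilon> A}
      \<le> \<Lambda> powr (real m * t) * exp ((2 * 2 ^ (s ^ 2 * m) / \<Lambda> - c / 8) * (p * real n ^ s))"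
  proof (rule prob_has_sparse_certificate_le[OF _ _ p_bounds \<open>0 < c\<close> \<epsilon>_bounds _ \<open>1 \<le> \<Lambda>\<close>])
    show "finite ?E" by (simp add: finite_imp_finite_nsets)
    show "real (card ?E) \<le> real n ^ s" using binomial_le_power[of n s] by (simp flip: of_nat_power)
    fix \<F> assume "\<F> \<subseteq> ?E"
    note card_forced_nonedges_le[OF finite_uniform[OF finite_lessThan this] this, of "c * real n ^ s" m f]
    then show "finite (forced_nonedges {..<n} s (c * real n ^ s) m f \<F>) \<and>
        real (card (forced_nonedges {..<n} s (c * real n ^ s) m f \<F>)) \<le> (2 ^ (s ^ 2 * m)) ^ card \<F>"
      by blast
  qed (auto simp: forced_nonedges_def anticliques_def)
  finally show ?thesis .
qed

lemma powr_mult_exp_le_exp_neg: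
  fixes c \<kappa> \<nu> \<Lambda> \<mu> C N :: real
  assumes "1 \<le> \<Lambda>" and "\<nu> \<le> c / 16" and "\<kappa> * ln \<Lambda> \<le> c / 32 * C"
    and "0 \<le> N" and "0 \<le> c" and "0 \<le> \<mu>" and "C * N \<le> \<mu>"
  shows "\<Lambda> powr (\<kappa> * N) * exp ((\<nu> - c / 8) * \<mu>) \<le> exp (- (c / 32) * \<mu>)"
proof -
  have "\<kappa> * ln \<Lambda> * N \<le> c / 32 * C * N" using assms(3,4) by (rule mult_right_mono)
  also have "\<dots> \<le> c / 32 * \<mu>" using assms(5,7) by (simp add: mult.assoc mult_left_mono)
  finally have "\<kappa> * ln \<Lambda> * N \<le> c / 32 * \<mu>" .
  moreover have "(\<nu> - c / 8) * \<mu> \<le> - (c / 16) * \<mu>" using assms(2,6) by (intro mult_right_mono) auto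
  ultimately have "\<kappa> * ln \<Lambda> * N + (\<nu> - c / 8) * \<mu> \<le> - (c / 32) * \<mu>" by simp
  moreover have "\<Lambda> powr (\<kappa> * N) * exp ((\<nu> - c / 8) * \<mu>) = exp (\<kappa> * ln \<Lambda> * N + (\<nu> - c / 8) * \<mu>)"
    using assms(1) by (simp add: powr_def exp_add mult_ac)
  ultimately show ?thesis by simp
qed

text \<open>There are \<open>exp (O(n powr (2 - a)))\<close> choices for the covering hyperedges. For large \<open>C\<close> this is
  negligible against \<open>exp (- \<Omega>(p n\<^sup>s))\<close>, as \<open>p n\<^sup>s \<ge> C * n powr (2 - a)\<close>.\<close>

lemma prob_not_resilient_ramsey_tendsto_0:
  fixes a c K :: real
  assumes "2 \<le> r" and "a \<le> 1" and "0 < c" and "0 < K"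
    and containers: "\<forall>\<^sub>F n in sequentially. has_containers (K * real n powr (2 - a)) m (clique_free {..<n} r)
      {C. c * real n ^ s \<le> real (card (anticliques {..<n} s C))}"
    and \<epsilon>_bounds: "0 \<le> \<epsilon>" "2 powr \<epsilon> \<le> 3 / 2" "2 powr \<epsilon> \<le> 1 + c / 8"
    and \<Lambda>_bounds: "1 \<le> \<Lambda>" "2 * 2 ^ (s ^ 2 * m) / \<Lambda> \<le> c / 16"
    and C_bounds: "1 \<le> C" "real m * K * ln \<Lambda> \<le> c / 32 * C"
    and p_bounds: "\<And>n. 0 \<le> p n \<and> p n \<le> 1"
    and p_large: "\<forall>\<^sub>F n in sequentially. C * real n powr (2 - real s - a) \<le> p n"
  shows "(\<lambda>n. measure_pmf.prob (random_hypergraph s n (p n)) {H. \<not> resilient_ramsey \<epsilon> s r H}) \<longlonglongrightarrow> 0"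
proof (rule tendsto_sandwich[OF always_eventually _ tendsto_const])
  show "\<forall>\<^sub>F n in sequentially. measure_pmf.prob (random_hypergraph s n (p n)) {H. \<not> resilient_ramsey \<epsilon> s r H}
      \<le> exp (- (c / 32)) ^ n"
    using containers p_large eventually_gt_at_top[of 0]
  proof eventually_elim
    case (elim n)
    define N where "N = real n powr (2 - a)"
    define \<mu> where "\<mu> = p n * real n ^ s"
    have "real n \<le> N" using powr_mono[of 1 "2 - a" "real n"] \<open>a \<le> 1\<close> elim(3) by (simp add: N_def)
    have "C * N = C * real n powr (2 - real s - a) * real n ^ s"
      using elim(3) by (simp add: N_def flip: powr_realpow powr_add)
    also have "\<dots> \<le> \<mu>" unfolding \<mu>_def using elim(2) by (rule mult_right_mono) simp
    finally have "C * N \<le> \<mu>" .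
    then have "real n \<le> \<mu>"
      using \<open>real n \<le> N\<close> C_bounds(1) mult_mono[of 1 C "real n" N] by simp
    have "measure_pmf.prob (random_hypergraph s n (p n)) {H. \<not> resilient_ramsey \<epsilon> s r H}
        \<le> \<Lambda> powr (real m * (K * N)) * exp ((2 * 2 ^ (s ^ 2 * m) / \<Lambda> - c / 8) * \<mu>)"
      unfolding \<mu>_def using elim(1) p_bounds[of n] \<open>0 < K\<close>
      by (intro prob_not_resilient_ramsey_le \<open>2 \<le> r\<close> \<open>0 < c\<close> \<epsilon>_bounds \<Lambda>_bounds(1)) (simp_all add: N_def)
    also have "\<dots> \<le> exp (- (c / 32) * \<mu>)"
      using powr_mult_exp_le_exp_neg[OF \<Lambda>_bounds C_bounds(2), of N \<mu>] \<open>C * N \<le> \<mu>\<close> \<open>real n \<le> \<mu>\<close> \<open>0 < c\<close>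
      by (simp add: N_def mult.assoc)
    also have "\<dots> \<le> exp (- (c / 32) * real n)" using \<open>real n \<le> \<mu>\<close> \<open>0 < c\<close> by simp
    finally show ?case by (simp only: exp_of_nat2_mult)
  qed
  show "(\<lambda>n. exp (- (c / 32)) ^ n) \<longlonglongrightarrow> 0" by (rule LIMSEQ_realpow_zero) (use \<open>0 < c\<close> in auto)
qed simp

lemma prob_tendsto_1_if_neg_tendsto_0:
  fixes M :: "nat \<Rightarrow> 'a pmf"
  assumes "(\<lambda>n. measure_pmf.prob (M n) {x. \<not> P x}) \<longlonglongrightarrow> 0"
  shows "(\<lambda>n. measure_pmf.prob (M n) {x. P x}) \<longlonglongrightarrow> 1"
proof -
  have "measure_pmf.prob (M n) {x. P x} = 1 - measure_pmf.prob (M n) {x. \<not> P x}" for n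
    using measure_pmf.prob_compl[of "{x. \<not> P x}" "M n"]
    by (simp add: Collect_neg_eq flip: Compl_eq_Diff_UNIV)
  then show ?thesis using tendsto_diff[OF tendsto_const[of 1] assms] by simp
qed

theorem resilient_ramsey_threshold:
  assumes "2 \<le> r"
  shows "\<exists>\<epsilon>>0. \<exists>C>0. \<forall>p::nat \<Rightarrow> real. (\<forall>n. 0 \<le> p n \<and> p n \<le> 1) \<longrightarrow>
    (\<forall>\<^sub>F n in sequentially. p n \<ge> C * real n powr (2 - real s - 1 / max_2_density (complete_graph r))) \<longrightarrow>
    (\<lambda>n. measure_pmf.prob (random_hypergraph s n (p n)) {H. resilient_ramsey \<epsilon> s r H}) \<longlonglongrightarrow> 1"
proof -
  define a where "a = 1 / max_2_density (complete_graph r)"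
  have "a \<le> 1" by (rule inverse_max_2_density_le_1[OF assms a_def])
  obtain c m K where "0 < c" "0 < K" and "\<forall>\<^sub>F n in sequentially. \<forall>V::nat set. card V = n \<longrightarrow>
      has_containers (K * real n powr (2 - a)) m (clique_free V r)
        {C. c * real n ^ s \<le> real (card (anticliques V s C))}"
    using clique_free_containers_many_anticliques[OF assms a_def] by blast
  from this(3) have containers: "\<forall>\<^sub>F n in sequentially.
      has_containers (K * real n powr (2 - a)) m (clique_free {..<n} r)
        {C. c * real n ^ s \<le> real (card (anticliques {..<n} s C))}"
    by eventually_elim simp
  define \<epsilon> where "\<epsilon> = log 2 (1 + min (c / 8) (1 / 2))"
  have \<epsilon>_bounds: "0 < \<epsilon>" "2 powr \<epsilon> \<le> 3 / 2" "2 powr \<epsilon> \<le> 1 + c / 8"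
    using \<open>0 < c\<close> by (auto simp: \<epsilon>_def)
  define q where "q = (2::real) ^ (s ^ 2 * m)"
  define \<Lambda> where "\<Lambda> = max 1 (32 * q / c)"
  have "1 \<le> \<Lambda>" "32 * q / c \<le> \<Lambda>" by (auto simp: \<Lambda>_def)
  moreover from this have "2 * q / \<Lambda> \<le> c / 16" using \<open>0 < c\<close> by (simp add: field_simps)
  ultimately have \<Lambda>_bounds: "1 \<le> \<Lambda>" "2 * 2 ^ (s ^ 2 * m) / \<Lambda> \<le> c / 16" by (simp_all add: q_def)
  define C where "C = 1 + 32 * (real m * K * ln \<Lambda>) / c"
  have C_bounds: "1 \<le> C" "real m * K * ln \<Lambda> \<le> c / 32 * C"
    using \<open>0 < c\<close> \<open>0 < K\<close> \<Lambda>_bounds(1) by (auto simp: C_def field_simps)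
  note neg_tendsto_0 = prob_not_resilient_ramsey_tendsto_0[OF assms \<open>a \<le> 1\<close> \<open>0 < c\<close> \<open>0 < K\<close>
      containers less_imp_le[OF \<epsilon>_bounds(1)] \<epsilon>_bounds(2,3) \<Lambda>_bounds C_bounds]
  show ?thesis
  proof (rule exI[of _ \<epsilon>], intro conjI exI[of _ C] allI impI prob_tendsto_1_if_neg_tendsto_0)
    fix p :: "nat \<Rightarrow> real"
    assume "\<forall>n. 0 \<le> p n \<and> p n \<le> 1"
      and "\<forall>\<^sub>F n in sequentially. p n \<ge> C * real n powr (2 - real s - 1 / max_2_density (complete_graph r))"
    then show "(\<lambda>n. measure_pmf.prob (random_hypergraph s n (p n)) {H. \<not> resilient_ramsey \<epsilon> s r H}) \<longlonglongrightarrow> 0"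
      by (intro neg_tendsto_0) (simp_all add: a_def)
  qed (use \<epsilon>_bounds(1) C_bounds(1) in auto)
qed

theorem theorem2p4:
  fixes s k :: nat
  assumes "s \<ge> 2" and "k \<ge> 3"
  shows "\<exists>C::real. C > 0 \<and>
    (\<forall>p :: nat \<Rightarrow> real.
      (\<forall>n. 0 \<le> p n \<and> p n \<le> 1) \<longrightarrow>
      (\<forall>\<^sub>F n in sequentially.
         p n \<ge> C * real n powr (2 - real s - 1 / max_2_density (complete_graph (k - 1)))) \<longrightarrow>
      (\<forall>\<epsilon> :: nat \<Rightarrow> real. \<epsilon> \<longlonglongrightarrow> 0 \<longrightarrow>
        (\<lambda>n. measure_pmf.prob (random_hypergraph s n (p n))
           {H. \<forall>H0. subhypergraph H0 H \<and>
                     real (card (edges H0)) \<ge> (1 - \<epsilon> n) * real (card (edges H)) \<longrightarrow>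
                     ramsey_arrow (primal_graph H0) (complete_graph s) (complete_graph (k - 1))})
          \<longlonglongrightarrow> 1))"
proof -
  have "2 \<le> k - 1" using assms(2) by simp
  then obtain \<epsilon>\<^sub>0 C where pos: "0 < \<epsilon>\<^sub>0" "0 < C" and threshold: "\<And>p. \<forall>n. 0 \<le> p n \<and> p n \<le> 1 \<Longrightarrow>
      \<forall>\<^sub>F n in sequentially. p n \<ge> C * real n powr (2 - real s - 1 / max_2_density (complete_graph (k - 1))) \<Longrightarrow>
      (\<lambda>n. measure_pmf.prob (random_hypergraph s n (p n)) {H. resilient_ramsey \<epsilon>\<^sub>0 s (k - 1) H}) \<longlonglongrightarrow> 1"
    using resilient_ramsey_threshold by blast
  show ?thesis
    unfolding resilient_ramsey_def[symmetric]
  proof (intro exI[of _ C] conjI allI impI)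
    fix p \<epsilon> :: "nat \<Rightarrow> real"
    assume p_assms: "\<forall>n. 0 \<le> p n \<and> p n \<le> 1"
      "\<forall>\<^sub>F n in sequentially. p n \<ge> C * real n powr (2 - real s - 1 / max_2_density (complete_graph (k - 1)))"
      and "\<epsilon> \<longlonglongrightarrow> 0"
    then have "\<forall>\<^sub>F n in sequentially. \<epsilon> n < \<epsilon>\<^sub>0" using order_tendstoD(2) pos(1) by blast
    then have "\<forall>\<^sub>F n in sequentially.
        measure_pmf.prob (random_hypergraph s n (p n)) {H. resilient_ramsey \<epsilon>\<^sub>0 s (k - 1) H}
        \<le> measure_pmf.prob (random_hypergraph s n (p n)) {H. resilient_ramsey (\<epsilon> n) s (k - 1) H}"
      by eventually_elim (auto intro!: measure_pmf.finite_measure_mono elim: resilient_ramsey_antimono)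
    then show "(\<lambda>n. measure_pmf.prob (random_hypergraph s n (p n)) {H. resilient_ramsey (\<epsilon> n) s (k - 1) H})
        \<longlonglongrightarrow> 1"
      by (rule tendsto_sandwich[OF _ always_eventually threshold[OF p_assms] tendsto_const]) simp
  qed (rule pos(2))
qed

end
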